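(* Let $X_1,X_2,\ldots$ be independent identically distributed random variables with $\mathsf{E}X_1=0$ and $0<\mathsf{E}X_1^2=\sigma^2<\infty$ ($\sigma>0$). For $\lambda>0$ let $N_\lambda$ have the Poisson distribution with parameter $\lambda$, with $N_\lambda,X_1,X_2,\ldots$ jointly independent, and let $S_{N_\lambda}=X_1+\ldots+X_{N_\lambda}$ (equal to $0$ if $N_\lambda=0$). Then for any $\lambda>0$ $$\sup_{z\ge 0}\Big|Q_{S_{N_\lambda}}(z)-\Phi_0\Big(\frac{z}{2\sigma\sqrt{\lambda}}\Big)\Big|\le\frac{7.4184}{\sigma^2}\,\mathsf{E}X_1^2\min\bigg\{1,\,\frac{|X_1|}{\sigma\sqrt{\lambda}}\bigg\}.$$
   Context: The concentration function of a random variable $\xi$ is $Q_\xi(z)=\sup_{x\in\mathbb{R}}\mathsf{P}(x\le\xi\le x+z)$, $z\ge 0$. $\Phi$ is the standard normal distribution function, and the folded normal distribution function is $\Phi_0(x)=2\Phi(x)-1$ for $x\ge 0$, $\Phi_0(x)=0$ for $x<0$. *)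

theory Defs
  imports "HOL-Probability.Probability"
begin

definition concentration :: "'a measure \<Rightarrow> ('a \<Rightarrow> real) \<Rightarrow> real \<Rightarrow> real" where
  "concentration M \<xi> z = (SUP x::real. \<P>(\<omega> in M. x \<le> \<xi> \<omega> \<and> \<xi> \<omega> \<le> x + z))"

definition std_normal_cdf :: "real \<Rightarrow> real" where
  "std_normal_cdf = cdf std_normal_distribution"

definition folded_normal_cdf :: "real \<Rightarrow> real" where
  "folded_normal_cdf x = (if 0 \<le> x then 2 * std_normal_cdf x - 1 else 0)"

text \<open>Indices start at 0, so the summands are \<open>X 0, \<dots>, X (N \<omega> - 1)\<close>.\<close>

definition random_sum :: "(nat \<Rightarrow> 'a \<Rightarrow> real) \<Rightarrow> ('a \<Rightarrow> nat) \<Rightarrow> 'a \<Rightarrow> real" where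
  "random_sum X N \<omega> = (\<Sum>i<N \<omega>. X i \<omega>)"

text \<open>
  Joint independence of the count \<open>N\<close> and all the \<open>X i\<close>, as one family of real random variables
  with \<open>N\<close> at index \<open>None\<close>. Viewing \<open>N\<close> as real-valued does not change the sigma-algebra
  it generates.
\<close>

definition jointly_indep :: "'a measure \<Rightarrow> ('a \<Rightarrow> nat) \<Rightarrow> (nat \<Rightarrow> 'a \<Rightarrow> real) \<Rightarrow> bool" where
  "jointly_indep M N X \<longleftrightarrow>
     prob_space.indep_vars M (\<lambda>_. borel) (case_option (\<lambda>\<omega>. real (N \<omega>)) X) UNIV"

text \<open>
  Suprema of reals are only meaningful for nonempty sets bounded above. The following facts show
  that this holds for \<^const>\<open>concentration\<close> and for the uniform distance between
  it and a rescaled \<^const>\<open>folded_normal_cdf\<close>.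
\<close>

lemma bdd_above_concentration:
  assumes "prob_space M"
  shows "bdd_above (range (\<lambda>x::real. \<P>(\<omega> in M. x \<le> \<xi> \<omega> \<and> \<xi> \<omega> \<le> x + z)))"
  using prob_space.prob_le_1[OF assms] by (intro bdd_aboveI[of _ 1]) auto

lemma concentration_bounds:
  assumes "prob_space M"
  shows "0 \<le> concentration M \<xi> z" "concentration M \<xi> z \<le> 1"
proof -
  show "0 \<le> concentration M \<xi> z"
    unfolding concentration_def
    by (rule cSUP_upper2[OF bdd_above_concentration[OF assms], of 0]) auto
  show "concentration M \<xi> z \<le> 1"
    unfolding concentration_def
    by (rule cSUP_least) (auto intro: prob_space.prob_le_1[OF assms])
qed

lemma abs_folded_normal_cdf_le: "\<bar>folded_normal_cdf x\<bar> \<le> 1"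
proof -
  interpret real_distribution std_normal_distribution
    by (rule real_dist_normal_dist)
  have "0 \<le> std_normal_cdf x" "std_normal_cdf x \<le> 1"
    by (auto simp: std_normal_cdf_def cdf_nonneg cdf_bounded_prob)
  then show ?thesis
    by (auto simp: folded_normal_cdf_def abs_if)
qed

lemma bdd_above_concentration_distance:
  assumes "prob_space M"
  shows "bdd_above ((\<lambda>z. \<bar>concentration M \<xi> z - folded_normal_cdf (z / c)\<bar>) ` A)"
proof (rule bdd_aboveI2)
  fix z
  show "\<bar>concentration M \<xi> z - folded_normal_cdf (z / c)\<bar> \<le> 2"
    using concentration_bounds[OF assms, of \<xi> z] abs_folded_normal_cdf_le[of "z / c"] by linarith
qed

end

theory Submission
  imports Defs
begin

text \<open>
  After dividing by \<open>\<sigma> * sqrt lambda\<close>, the sum \<open>W\<close> has variance 1, and for a compound Poisson variable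
  with centered jumps \<open>E (W f (W)) = E (f' (W + T))\<close> with \<open>T\<close> \<^emph>\<open>independent\<close> of \<open>W\<close>: here \<open>T = U Z\<close> with \<open>U\<close>
  uniform on \<open>[0, 1]\<close> and \<open>Z\<close> of law \<open>lambda * y\<^sup>2\<close> times the law of the jumps. The right-hand side of
  the theorem is thus a multiple of \<open>\<delta> = E (min 1 \<bar>Z\<bar>)\<close>. Since \<open>f' (w) = w f (w) + 1\<^bsub>w \<le> x\<^esub> - \<Phi> (x)\<close>
  for the Stein solution \<open>f\<close>, the distribution function of \<open>W + T\<close> differs from \<open>\<Phi>\<close> only by
  \<open>E (W f (W) - (W + T) f (W + T))\<close>, which contains no indicator and is at most
  \<open>E (min 1 (13 / 4 * \<bar>T\<bar>))\<close>. Independence of \<open>T\<close> allows passing from \<open>W + T\<close> back to \<open>W\<close>, because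
  \<open>\<bar>T\<bar> \<le> 7 / 4 * \<delta>\<close> with probability at least 6/7. This gives Kolmogorov distance at most
  \<open>3.7092 * \<delta>\<close> when \<open>7.4184 * \<delta> < 1\<close>; the concentration function costs a factor 2.
\<close>

section \<open>The standard normal distribution function\<close>

lemma std_normal_density_deriv:
  "(std_normal_density has_real_derivative - x * std_normal_density x) (at x)"
  unfolding std_normal_density_def
  by (auto intro!: derivative_eq_intros simp: field_simps power2_eq_square)

text \<open>The rational 41/100 replaces 1 / sqrt (2 pi), which is about 0.399, in all later
  estimates. It is large enough for pi > 3 to suffice, since (100/41)^2 < 6.\<close>

lemma std_normal_density_le: "std_normal_density x \<le> 41 / 100"
proof -
  have "(100/41)\<^sup>2 \<le> 2 * pi" using pi_gt3 by (simp add: power2_eq_square)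
  then have "100 / 41 \<le> sqrt (2 * pi)" by (rule real_le_rsqrt)
  then have "1 / sqrt (2 * pi) \<le> 41 / 100" by (simp add: field_simps)
  moreover have "exp (- x\<^sup>2 / 2) \<le> 1" by simp
  ultimately have "1 / sqrt (2 * pi) * exp (- x\<^sup>2 / 2) \<le> 41 / 100 * 1"
    by (intro mult_mono) auto
  then show ?thesis by (simp add: std_normal_density_def)
qed

lemma continuous_on_std_normal_density: "continuous_on A std_normal_density"
  using std_normal_density_deriv by (meson DERIV_isCont continuous_at_imp_continuous_on)

lemma std_normal_cdf_diff:
  assumes "a < b"
  shows "std_normal_cdf b - std_normal_cdf a = integral {a..b} std_normal_density"
proof -
  interpret real_distribution std_normal_distribution by (rule real_dist_normal_dist)
  have si: "set_integrable lborel {a..b} std_normal_density"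
    unfolding set_integrable_def by (rule integrable_mult_indicator) auto
  have "std_normal_cdf b - std_normal_cdf a = (LINT x|std_normal_distribution. indicator {a<..b} x)"
    using assms by (simp add: std_normal_cdf_def cdf_diff_eq)
  also have "\<dots> = (LINT x|lborel. std_normal_density x * indicator {a<..b} x)"
    by (subst integral_density) auto
  also have "\<dots> = (LINT x:{a..b}|lborel. std_normal_density x)"
    unfolding set_lebesgue_integral_def
  proof (rule integral_cong_AE)
    show "AE x in lborel. std_normal_density x * indicator {a<..b} x = indicator {a..b} x *\<^sub>R std_normal_density x"
      using AE_lborel_singleton[of a] by eventually_elim (auto simp: indicator_def)
  qed auto
  also have "\<dots> = integral {a..b} std_normal_density"
    by (rule set_borel_integral_eq_integral[OF si])
  finally show ?thesis .
qed

text \<open>Near x the distribution function differs by a constant from the primitive of the density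
  that starts at x - 1, so the fundamental theorem on a compact interval is enough.\<close>

lemma DERIV_std_normal_cdf: "DERIV std_normal_cdf x :> std_normal_density x"
proof -
  let ?a = "x - 1" and ?b = "x + 1"
  have "((\<lambda>u. integral {?a..u} std_normal_density) has_real_derivative std_normal_density x) (at x within {?a..?b})"
    by (rule integral_has_real_derivative) (auto intro: continuous_on_std_normal_density)
  then have "DERIV (\<lambda>u. integral {?a..u} std_normal_density + std_normal_cdf ?a) x :> std_normal_density x"
    by (subst (asm) at_within_interior) (auto intro!: derivative_eq_intros)
  then show ?thesis
  proof (rule DERIV_cong_ev[THEN iffD1, OF refl _ refl, rotated])
    have "\<forall>\<^sub>F u in nhds x. ?a < u"
      using eventually_nhds_in_open[of "{?a<..}" x] by simp
    then show "\<forall>\<^sub>F u in nhds x. integral {?a..u} std_normal_density + std_normal_cdf ?a = std_normal_cdf u"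
      by eventually_elim (simp flip: std_normal_cdf_diff)
  qed
qed

lemmas DERIV_std_normal_cdf' [derivative_intros] =
  DERIV_std_normal_cdf[THEN DERIV_chain2]
lemmas DERIV_std_normal_density' [derivative_intros] =
  std_normal_density_deriv[THEN DERIV_chain2]

lemma std_normal_cdf_bounds: "0 \<le> std_normal_cdf x" "std_normal_cdf x \<le> 1"
proof -
  interpret real_distribution std_normal_distribution by (rule real_dist_normal_dist)
  show "0 \<le> std_normal_cdf x" "std_normal_cdf x \<le> 1"
    by (auto simp: std_normal_cdf_def cdf_nonneg cdf_bounded_prob)
qed

lemma std_normal_cdf_mono: "x \<le> y \<Longrightarrow> std_normal_cdf x \<le> std_normal_cdf y"
proof -
  interpret real_distribution std_normal_distribution by (rule real_dist_normal_dist)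
  show "x \<le> y \<Longrightarrow> std_normal_cdf x \<le> std_normal_cdf y"
    by (simp add: std_normal_cdf_def cdf_nondecreasing)
qed

lemma std_normal_cdf_at_top: "(std_normal_cdf \<longlongrightarrow> 1) at_top"
  and std_normal_cdf_at_bot: "(std_normal_cdf \<longlongrightarrow> 0) at_bot"
proof -
  interpret real_distribution std_normal_distribution by (rule real_dist_normal_dist)
  show "(std_normal_cdf \<longlongrightarrow> 1) at_top" "(std_normal_cdf \<longlongrightarrow> 0) at_bot"
    unfolding std_normal_cdf_def by (rule cdf_lim_at_top_prob cdf_lim_at_bot)+
qed

text \<open>The density is even, so Phi(-x) + Phi(x) has derivative 0; its constant value is its
  limit 1 at infinity.\<close>

lemma std_normal_cdf_minus: "std_normal_cdf (- x) = 1 - std_normal_cdf x"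
proof -
  let ?h = "\<lambda>x. std_normal_cdf (- x) + std_normal_cdf x"
  have const: "?h x = ?h y" for x y
  proof (rule DERIV_isconst_all[of ?h])
    show "\<forall>x. DERIV ?h x :> 0"
      by (auto intro!: derivative_eq_intros simp: std_normal_density_def)
  qed
  have "((\<lambda>x. std_normal_cdf (- x)) \<longlongrightarrow> 0) at_top"
    using std_normal_cdf_at_bot by (simp add: filterlim_at_bot_mirror)
  then have "(?h \<longlongrightarrow> 0 + 1) at_top"
    by (intro tendsto_add std_normal_cdf_at_top)
  moreover have "?h = (\<lambda>_. ?h x)" using const by blast
  ultimately have "((\<lambda>_::real. ?h x) \<longlongrightarrow> 1) at_top" by simp
  then have "?h x = 1" by (simp add: tendsto_const_iff)
  then show ?thesis by simp
qed

lemma std_normal_cdf_lipschitz: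
  assumes "x \<le> y" shows "std_normal_cdf y - std_normal_cdf x \<le> 41 / 100 * (y - x)"
proof (cases "x = y")
  case False
  then obtain z where "std_normal_cdf y - std_normal_cdf x = (y - x) * std_normal_density z"
    using MVT2[of x y std_normal_cdf std_normal_density] DERIV_std_normal_cdf assms by force
  then show ?thesis
    using mult_left_mono[OF std_normal_density_le[of z], of "y - x"] assms by simp
qed simp

lemma std_normal_density_at_top: "(std_normal_density \<longlongrightarrow> 0) at_top"
proof -
  have "((\<lambda>x::real. (1 / sqrt (2 * pi)) * exp (- x\<^sup>2 / 2)) \<longlongrightarrow> 0) at_top"
    by real_asymp
  then show ?thesis by (simp add: std_normal_density_def[abs_def])
qed

text \<open>For x > 0 the difference phi(x) / x - (1 - Phi(x)) has derivative - phi(x) / x^2 < 0 and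
  tends to 0 at infinity, hence is positive.\<close>

lemma mills_ratio_le:
  assumes "0 \<le> x" shows "x * (1 - std_normal_cdf x) \<le> std_normal_density x"
proof (cases "x = 0")
  case True then show ?thesis using normal_density_pos[of 1 0 0] by simp
next
  case False
  let ?h = "\<lambda>x. std_normal_density x / x - (1 - std_normal_cdf x)"
  have "0 < ?h x"
  proof (rule DERIV_neg_imp_decreasing_at_top[where f = ?h and b = x])
    fix y assume "x \<le> y"
    then have "y > 0" using False assms by simp
    then have "DERIV ?h y :> - (std_normal_density y / y\<^sup>2)"
      by (auto intro!: derivative_eq_intros simp: field_simps power2_eq_square)
    moreover have "- (std_normal_density y / y\<^sup>2) < 0"
      using \<open>y > 0\<close> normal_density_pos[of 1 0 y] by simp
    ultimately show "\<exists>d. DERIV ?h y :> d \<and> d < 0" by blast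
  next
    have inv: "((\<lambda>x::real. 1 / x) \<longlongrightarrow> 0) at_top" by real_asymp
    have "((\<lambda>x. std_normal_density x * (1 / x) - (1 - std_normal_cdf x)) \<longlongrightarrow> 0 * 0 - (1 - 1)) at_top"
      using tendsto_diff[OF tendsto_mult[OF std_normal_density_at_top inv] tendsto_diff[OF tendsto_const std_normal_cdf_at_top]]
      .
    then show "(?h \<longlongrightarrow> 0) at_top" by simp
  qed
  then show ?thesis using False assms by (simp add: field_simps)
qed

text \<open>Among intervals of length z the centered one carries the most normal mass: the
  derivative phi(x + z) - phi(x) changes sign from plus to minus at x = - z / 2. Thus the folded
  normal distribution function at z / 2 is the concentration function of the normal law at
  z.\<close>

lemma std_normal_cdf_interval_le:
  assumes "0 \<le> z"
  shows "std_normal_cdf (x + z) - std_normal_cdf x \<le> 2 * std_normal_cdf (z / 2) - 1"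
proof -
  have dens: "std_normal_density u \<le> std_normal_density v" if "\<bar>v\<bar> \<le> \<bar>u\<bar>" for u v :: real
    using that by (simp add: std_normal_density_def divide_right_mono flip: abs_le_square_iff)
  let ?h = "\<lambda>x. std_normal_cdf (x + z) - std_normal_cdf x"
  have der: "DERIV ?h y :> std_normal_density (y + z) - std_normal_density y" for y
    by (auto intro!: derivative_eq_intros)
  have "?h x \<le> ?h (- z / 2)"
  proof (cases "x \<le> - z / 2")
    case True
    then show ?thesis
    proof (rule DERIV_nonneg_imp_nondecreasing)
      fix y assume "x \<le> y" "y \<le> - z / 2"
      then have "\<bar>y + z\<bar> \<le> \<bar>y\<bar>" using assms by linarith
      then show "\<exists>d. DERIV ?h y :> d \<and> 0 \<le> d" using der[of y] dens by fastforce
    qed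
  next
    case False
    then have "- z / 2 \<le> x" by simp
    then show ?thesis
    proof (rule DERIV_nonpos_imp_nonincreasing)
      fix y assume "- z / 2 \<le> y" "y \<le> x"
      then have "\<bar>y\<bar> \<le> \<bar>y + z\<bar>" using assms by linarith
      then show "\<exists>d. DERIV ?h y :> d \<and> d \<le> 0" using der[of y] dens by fastforce
    qed
  qed
  then show ?thesis using std_normal_cdf_minus[of "z / 2"] by (simp add: field_simps)
qed

section \<open>The solution of Stein's equation for a half-line\<close>

text \<open>The bounded solution f of f'(w) - w f(w) = 1_{w \<le> x} - Phi(x), continuous with a
  kink at w = x.\<close>

definition stein_sol :: "real \<Rightarrow> real \<Rightarrow> real" where
  "stein_sol x w = (if w \<le> x then std_normal_cdf w * (1 - std_normal_cdf x) / std_normal_density w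
     else std_normal_cdf x * (1 - std_normal_cdf w) / std_normal_density w)"

text \<open>The derivative of \<open>stein_sol x\<close> as prescribed by Stein's equation. At the
  kink w = x it takes the value of the left derivative, so that it is defined everywhere.\<close>

definition stein_rhs :: "real \<Rightarrow> real \<Rightarrow> real" where
  "stein_rhs x w = w * stein_sol x w + (indicator {..x} w - std_normal_cdf x)"

lemma std_normal_density_neq_0: "std_normal_density x \<noteq> 0"
  using normal_density_pos[of 1 0 x] by simp

lemma stein_sol_nonneg: "0 \<le> stein_sol x w"
  unfolding stein_sol_def using std_normal_cdf_bounds by simp

lemma DERIV_stein_sol:
  assumes "w \<noteq> x" shows "DERIV (stein_sol x) w :> stein_rhs x w"
proof (cases "w < x")
  case True
  have "DERIV (\<lambda>w. std_normal_cdf w * (1 - std_normal_cdf x) / std_normal_density w) w :> stein_rhs x w"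
    using True std_normal_density_neq_0[of w]
    by (auto intro!: derivative_eq_intros simp: stein_rhs_def stein_sol_def field_simps power2_eq_square)
  moreover have "\<forall>\<^sub>F u in nhds w. std_normal_cdf u * (1 - std_normal_cdf x) / std_normal_density u = stein_sol x u"
    using eventually_nhds_in_open[of "{..<x}" w] True
    by (auto elim!: eventually_mono simp: stein_sol_def)
  ultimately show ?thesis by (subst (asm) DERIV_cong_ev[OF refl _ refl])
next
  case False
  then have "x < w" using assms by simp
  have "DERIV (\<lambda>w. std_normal_cdf x * (1 - std_normal_cdf w) / std_normal_density w) w :> stein_rhs x w"
    using \<open>x < w\<close> std_normal_density_neq_0[of w]
    by (auto intro!: derivative_eq_intros simp: stein_rhs_def stein_sol_def field_simps power2_eq_square)
  moreover have "\<forall>\<^sub>F u in nhds w. std_normal_cdf x * (1 - std_normal_cdf u) / std_normal_density u = stein_sol x u"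
    using eventually_nhds_in_open[of "{x<..}" w] \<open>x < w\<close>
    by (auto elim!: eventually_mono simp: stein_sol_def)
  ultimately show ?thesis by (subst (asm) DERIV_cong_ev[OF refl _ refl])
qed

lemma isCont_std_normal: "isCont std_normal_cdf x" "isCont std_normal_density x"
  using DERIV_std_normal_cdf std_normal_density_deriv by (blast intro: DERIV_isCont)+

lemma continuous_on_stein_sol: "continuous_on A (stein_sol x)"
proof -
  have "continuous_on ({..x} \<union> {x..}) (\<lambda>w. if w \<le> x then std_normal_cdf w * (1 - std_normal_cdf x) / std_normal_density w
     else std_normal_cdf x * (1 - std_normal_cdf w) / std_normal_density w)"
  proof (rule continuous_on_If)
    show "continuous_on {..x} (\<lambda>w. std_normal_cdf w * (1 - std_normal_cdf x) / std_normal_density w)"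
      "continuous_on {x..} (\<lambda>w. std_normal_cdf x * (1 - std_normal_cdf w) / std_normal_density w)"
      using isCont_std_normal std_normal_density_neq_0
      by (auto intro!: continuous_intros continuous_at_imp_continuous_on)
  qed auto
  then have "continuous_on UNIV (stein_sol x)"
    unfolding stein_sol_def[abs_def] by (rule continuous_on_subset) auto
  then show ?thesis by (rule continuous_on_subset) simp
qed

lemma mills_ratio_le':
  assumes "w \<le> 0" shows "- w * std_normal_cdf w \<le> std_normal_density w"
  using mills_ratio_le[of "- w"] assms by (simp add: std_normal_cdf_minus std_normal_density_def)

text \<open>By monotonicity of Phi, \<open>stein_sol\<close> is at most each of its two branch
  formulas on the whole line. The Mills ratio bound then controls one branch for w \<ge> 0 and the
  other for w \<le> 0; on the opposite half-line the sign of w suffices. The two bounds confine w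
  f(w) to an interval of length 1.\<close>

lemma stein_sol_times_bounds:
  fixes x w :: real
  shows "w * stein_sol x w \<le> std_normal_cdf x" "std_normal_cdf x - 1 \<le> w * stein_sol x w"
proof -
  let ?P = std_normal_cdf and ?d = "std_normal_density w"
  note b = std_normal_cdf_bounds
  have d: "0 < ?d" by (simp add: normal_density_pos)
  have up: "w * ((1 - ?P w) / ?d) \<le> 1" if "0 \<le> w"
    using mills_ratio_le[OF that] d by (simp add: divide_simps)
  have lo: "- w * (?P w / ?d) \<le> 1" if "w \<le> 0"
    using mills_ratio_le'[OF that] d by (simp add: divide_simps)
  have f_up: "stein_sol x w \<le> (1 - ?P w) / ?d * ?P x"
  proof (cases "w \<le> x")
    case True
    have "?P w * (1 - ?P x) \<le> ?P x * (1 - ?P w)"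
      using std_normal_cdf_mono[OF True] by (simp add: algebra_simps)
    then show ?thesis using d True by (simp add: stein_sol_def divide_simps mult.commute)
  qed (simp add: stein_sol_def mult.commute)
  have f_lo: "stein_sol x w \<le> ?P w / ?d * (1 - ?P x)"
  proof (cases "w \<le> x")
    case False
    have "?P x * (1 - ?P w) \<le> ?P w * (1 - ?P x)"
      using std_normal_cdf_mono[of x w] False by (simp add: algebra_simps)
    then show ?thesis using d False by (simp add: stein_sol_def divide_simps mult.commute)
  qed (simp add: stein_sol_def)
  show "w * stein_sol x w \<le> ?P x"
  proof (cases "0 \<le> w")
    case True
    have "w * stein_sol x w \<le> w * ((1 - ?P w) / ?d) * ?P x"
      using mult_left_mono[OF f_up True] by (simp add: mult.assoc)
    also have "\<dots> \<le> 1 * ?P x" by (intro mult_right_mono up True b)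
    finally show ?thesis by simp
  next
    case False
    then have "w * stein_sol x w \<le> 0" by (simp add: mult_nonpos_nonneg stein_sol_nonneg)
    then show ?thesis using b[of x] by linarith
  qed
  show "?P x - 1 \<le> w * stein_sol x w"
  proof (cases "w \<le> 0")
    case True
    have "- w * stein_sol x w \<le> - w * (?P w / ?d) * (1 - ?P x)"
      using mult_left_mono[OF f_lo, of "- w"] True by (simp add: mult.assoc)
    also have "\<dots> \<le> 1 * (1 - ?P x)" using b[of x] by (intro mult_right_mono lo True) auto
    finally show ?thesis by simp
  next
    case False
    then have "0 \<le> w * stein_sol x w" by (simp add: stein_sol_nonneg)
    then show ?thesis using b[of x] by linarith
  qed
qed

text \<open>Left of x the indicator term moves the range [Phi(x) - 1, Phi(x)] of w f(w) onto [0, 1],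
  right of x onto [-1, 0].\<close>

lemma abs_stein_rhs_le: "\<bar>stein_rhs x w\<bar> \<le> 1"
  using stein_sol_times_bounds[where w=w and x=x] std_normal_cdf_bounds[of x]
  by (auto simp: stein_rhs_def indicator_def)

text \<open>The kink at x is a single exceptional point, which the fundamental theorem tolerates
  because \<open>stein_sol x\<close> is continuous.\<close>

lemma stein_sol_has_integral:
  assumes "a \<le> b"
  shows "(stein_rhs x has_integral (stein_sol x b - stein_sol x a)) {a..b}"
  using assms DERIV_stein_sol
  by (intro fundamental_theorem_of_calculus_strong[of "{x}"] continuous_on_stein_sol)
    (auto simp flip: has_real_derivative_iff_has_vector_derivative)

lemma stein_sol_lipschitz: "\<bar>stein_sol x b - stein_sol x a\<bar> \<le> \<bar>b - a\<bar>"
proof -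
  have *: "\<bar>stein_sol x b - stein_sol x a\<bar> \<le> b - a" if "a \<le> b" for a b
    using has_integral_bound[of 1 "stein_rhs x" "stein_sol x b - stein_sol x a" a b]
      stein_sol_has_integral[OF that] abs_stein_rhs_le that by simp
  show ?thesis
    using *[of a b] *[of b a] by (cases "a \<le> b") (auto simp: abs_minus_commute)
qed

text \<open>Since w f(w) is at most 1 in absolute value, f \<le> 1 outside (-1, 1); the Lipschitz
  constant 1 adds at most 1 when moving inside from an endpoint.\<close>

lemma stein_sol_le: "stein_sol x w \<le> 2"
proof -
  have far: "stein_sol x v \<le> 1" if "1 \<le> \<bar>v\<bar>" for v
  proof -
    have "\<bar>v * stein_sol x v\<bar> \<le> 1"
      using stein_sol_times_bounds[where w=v and x=x] std_normal_cdf_bounds[of x] by linarith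
    moreover have "1 * stein_sol x v \<le> \<bar>v\<bar> * stein_sol x v"
      using that by (intro mult_right_mono stein_sol_nonneg)
    ultimately show ?thesis by (simp add: abs_mult stein_sol_nonneg)
  qed
  consider "1 \<le> \<bar>w\<bar>" | "0 \<le> w" "w \<le> 1" | "- 1 \<le> w" "w \<le> 0" by linarith
  then show ?thesis
  proof cases
    case 1 then show ?thesis using far[of w] by simp
  next
    case 2 then show ?thesis using far[of 1] stein_sol_lipschitz[of x w 1] by simp
  next
    case 3 then show ?thesis using far[of "- 1"] stein_sol_lipschitz[of x w "- 1"] by simp
  qed
qed

lemma borel_measurable_stein_sol [measurable]: "stein_sol x \<in> borel_measurable borel"
  by (intro borel_measurable_continuous_onI continuous_on_stein_sol)

lemma borel_measurable_stein_rhs [measurable]: "stein_rhs x \<in> borel_measurable borel"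
  unfolding stein_rhs_def[abs_def] by measurable

text \<open>The linear bound splits the difference into w (f(w) - f(w + t)) - t f(w + t) and uses
  the Lipschitz constant 1 and f \<le> 2. The bound 1 holds because both values lie in
  [Phi(x) - 1, Phi(x)]; it yields the truncation in the final estimate.\<close>

lemma stein_sol_times_diff_le:
  "\<bar>w * stein_sol x w - (w + t) * stein_sol x (w + t)\<bar> \<le> min 1 ((\<bar>w\<bar> + 2) * \<bar>t\<bar>)"
proof -
  let ?f = "stein_sol x"
  have "w * ?f w - (w + t) * ?f (w + t) = w * (?f w - ?f (w + t)) - t * ?f (w + t)"
    by (simp add: algebra_simps)
  also have "\<bar>\<dots>\<bar> \<le> \<bar>w\<bar> * \<bar>?f w - ?f (w + t)\<bar> + \<bar>t\<bar> * ?f (w + t)"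
    using stein_sol_nonneg[of x "w + t"]
    by (intro order_trans[OF abs_triangle_ineq4]) (simp add: abs_mult)
  also have "\<dots> \<le> \<bar>w\<bar> * \<bar>t\<bar> + \<bar>t\<bar> * 2"
    using stein_sol_lipschitz[of x w "w + t"] stein_sol_le[of x "w + t"]
    by (intro add_mono mult_left_mono) auto
  finally have "\<bar>w * ?f w - (w + t) * ?f (w + t)\<bar> \<le> (\<bar>w\<bar> + 2) * \<bar>t\<bar>"
    by (simp add: algebra_simps)
  moreover have "\<bar>w * ?f w - (w + t) * ?f (w + t)\<bar> \<le> 1"
    using stein_sol_times_bounds[where w=w and x=x] stein_sol_times_bounds[where w="w + t" and x=x] by linarith
  ultimately show ?thesis by simp
qed

section \<open>Kolmogorov distance and smoothing\<close>

lemma integrable_bounded_real: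
  fixes f :: "real \<Rightarrow> real"
  assumes "real_distribution \<mu>" "f \<in> borel_measurable borel" "\<And>x. \<bar>f x\<bar> \<le> B"
  shows "integrable \<mu> f"
proof -
  interpret real_distribution \<mu> by fact
  show ?thesis using assms by (intro integrable_const_bound[where B = B]) auto
qed

lemma real_distribution_cdf_shift:
  assumes "real_distribution \<mu>"
  shows "cdf \<mu> (x - t) = (LINT w|\<mu>. indicator {..x} (w + t))"
proof -
  interpret real_distribution \<mu> by fact
  have "indicator {..x} (w + t) = (indicator {..x - t} w :: real)" for w
    by (auto simp: indicator_def)
  then show ?thesis by (simp add: cdf_def2)
qed

lemma borel_measurable_cdf:
  assumes "real_distribution \<mu>"
  shows "cdf \<mu> \<in> borel_measurable borel"
proof -
  interpret real_distribution \<mu> by fact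
  show ?thesis by (rule borel_measurable_mono) (simp add: mono_def cdf_nondecreasing)
qed

text \<open>With \<open>\<mu>\<close> the law of W and \<open>K\<close> that of an independent T,
  the integral of \<open>cdf \<mu> (x - t)\<close> is the distribution function of W + T at x.
  Inserting Stein's equation into the hypothesis \<open>zb\<close> leaves the mean of w f(w) at W
  minus its mean at W + T. The constant is 13/4 = 5/4 + 2, from E|W| \<le> 5/4 and f \<le>
  2.\<close>

lemma zero_bias_kolmogorov:
  assumes \<mu>: "real_distribution \<mu>" and K: "real_distribution K"
    and int: "integrable \<mu> (\<lambda>w. w)" and m: "(LINT w|\<mu>. \<bar>w\<bar>) \<le> 5 / 4"
    and zb: "(LINT w|\<mu>. w * stein_sol x w) = (LINT t|K. LINT w|\<mu>. stein_rhs x (w + t))"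
  shows "\<bar>(LINT t|K. cdf \<mu> (x - t)) - std_normal_cdf x\<bar> \<le> (LINT t|K. min 1 (13 / 4 * \<bar>t\<bar>))"
proof -
  interpret \<mu>: real_distribution \<mu> by fact
  interpret K: real_distribution K by fact
  note [measurable_cong] = \<mu>.events_eq_borel K.events_eq_borel
  let ?g = "\<lambda>w. w * stein_sol x w"
  let ?G = "\<lambda>t. LINT w|\<mu>. ?g (w + t)"
  have g1: "\<bar>?g w\<bar> \<le> 1" for w
    using stein_sol_times_bounds[where x=x and w=w] std_normal_cdf_bounds[of x] by linarith
  have ig: "integrable \<mu> (\<lambda>w. ?g (w + t))" for t
    using g1 by (intro integrable_bounded_real[OF \<mu>, of _ 1]) auto
  have ig0: "integrable \<mu> ?g" using ig[of 0] by simp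
  have ii: "integrable \<mu> (\<lambda>w. indicator {..x} (w + t) :: real)" for t
    by (intro integrable_bounded_real[OF \<mu>, of _ 1]) (auto simp: indicator_def)
  have rhs: "(LINT w|\<mu>. stein_rhs x (w + t)) = ?G t + cdf \<mu> (x - t) - std_normal_cdf x" for t
    unfolding stein_rhs_def real_distribution_cdf_shift[OF \<mu>]
    using ig[of t] ii[of t] by (simp add: \<mu>.prob_space[simplified])
  have diff: "\<bar>(LINT w|\<mu>. ?g w) - ?G t\<bar> \<le> min 1 (13 / 4 * \<bar>t\<bar>)" for t
  proof -
    have d: "(LINT w|\<mu>. ?g w) - ?G t = (LINT w|\<mu>. ?g w - ?g (w + t))"
      using ig0 ig[of t] by simp
    have id: "integrable \<mu> (\<lambda>w. \<bar>?g w - ?g (w + t)\<bar>)" using ig0 ig[of t] by simp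
    have "\<bar>(LINT w|\<mu>. ?g w) - ?G t\<bar> \<le> (LINT w|\<mu>. \<bar>?g w - ?g (w + t)\<bar>)"
      unfolding d by (rule integral_abs_bound)
    moreover have "\<dots> \<le> (LINT w|\<mu>. 1)"
      using stein_sol_times_diff_le[of _ x t] id by (intro integral_mono) auto
    moreover have "(LINT w|\<mu>. \<bar>?g w - ?g (w + t)\<bar>) \<le> (LINT w|\<mu>. \<bar>w\<bar> * \<bar>t\<bar> + 2 * \<bar>t\<bar>)"
      using stein_sol_times_diff_le[of _ x t] id int
      by (intro integral_mono) (auto simp: algebra_simps)
    moreover have "(LINT w|\<mu>. \<bar>w\<bar> * \<bar>t\<bar> + 2 * \<bar>t\<bar>) = (LINT w|\<mu>. \<bar>w\<bar>) * \<bar>t\<bar> + 2 * \<bar>t\<bar>"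
      using int by (simp add: \<mu>.prob_space[simplified])
    moreover have "(LINT w|\<mu>. \<bar>w\<bar>) * \<bar>t\<bar> \<le> 5 / 4 * \<bar>t\<bar>" using m by (rule mult_right_mono) simp
    ultimately show ?thesis by (simp add: \<mu>.prob_space[simplified])
  qed
  have iG: "integrable K ?G"
  proof (rule integrable_bounded_real[OF K])
    show "\<bar>?G t\<bar> \<le> \<bar>LINT w|\<mu>. ?g w\<bar> + 1" for t
      using order_trans[OF diff[of t] min.cobounded1] by linarith
  qed measurable
  have ic: "integrable K (\<lambda>t. cdf \<mu> (x - t))"
    using borel_measurable_cdf[OF \<mu>] \<mu>.cdf_nonneg \<mu>.cdf_bounded_prob
    by (intro integrable_bounded_real[OF K, of _ 1]) auto
  have "(LINT w|\<mu>. ?g w) = (LINT t|K. ?G t) + (LINT t|K. cdf \<mu> (x - t)) - std_normal_cdf x"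
    unfolding zb rhs using iG ic by (simp add: K.prob_space[simplified])
  then have "(LINT t|K. cdf \<mu> (x - t)) - std_normal_cdf x = (LINT t|K. (LINT w|\<mu>. ?g w) - ?G t)"
    using iG by (simp add: K.prob_space[simplified])
  also have "\<bar>\<dots>\<bar> \<le> (LINT t|K. \<bar>(LINT w|\<mu>. ?g w) - ?G t\<bar>)"
    by (rule integral_abs_bound)
  also have "\<dots> \<le> (LINT t|K. min 1 (13 / 4 * \<bar>t\<bar>))"
    using iG diff by (intro integral_mono integrable_bounded_real[OF K, of "\<lambda>t. min 1 (13 / 4 * \<bar>t\<bar>)" 1]) auto
  finally show ?thesis .
qed

text \<open>
  Evaluating at \<open>x + \<epsilon>\<close> (or \<open>x - \<epsilon>\<close>) makes monotonicity of the distribution function usable on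
  \<open>{\<bar>t\<bar> \<le> \<epsilon>}\<close>; on the rest one loses at most the supremum of the distances itself, which is
  absorbed because that set has small measure.
\<close>

lemma kolmogorov_deconvolution:
  assumes \<mu>: "real_distribution \<mu>" and K: "real_distribution K"
    and R: "\<And>x. \<bar>(LINT t|K. cdf \<mu> (x - t)) - std_normal_cdf x\<bar> \<le> R"
    and \<epsilon>: "0 \<le> \<epsilon>" and small: "measure K {t. \<epsilon> < \<bar>t\<bar>} \<le> 1 / 7"
  shows "\<bar>cdf \<mu> x - std_normal_cdf x\<bar>
    \<le> 7 / 5 * (R + (LINT t|K. min 1 (41 / 100 * \<bar>t\<bar>))) + 6 / 5 * (41 / 100 * \<epsilon>)"
proof -
  interpret \<mu>: real_distribution \<mu> by fact
  interpret K: real_distribution K by fact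
  note [measurable_cong] = \<mu>.events_eq_borel K.events_eq_borel
  note [measurable] = borel_measurable_cdf[OF \<mu>]
  let ?d = "\<lambda>x. cdf \<mu> x - std_normal_cdf x"
  let ?m = "\<lambda>t::real. min 1 (41 / 100 * \<bar>t\<bar>)"
  define T where "T = (LINT t|K. ?m t)"
  define A where "A = {t::real. \<epsilon> < \<bar>t\<bar>}"
  define \<alpha> where "\<alpha> = measure K A"
  define D where "D = (SUP x. \<bar>?d x\<bar>)"
  have [measurable]: "A \<in> sets borel" unfolding A_def by measurable
  have bdd: "bdd_above (range (\<lambda>x. \<bar>?d x\<bar>))"
  proof (rule bdd_aboveI2)
    show "\<bar>?d x\<bar> \<le> 1" for x
      using \<mu>.cdf_nonneg[of x] \<mu>.cdf_bounded_prob[of x] std_normal_cdf_bounds[of x] by linarith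
  qed
  have dD: "\<bar>?d y\<bar> \<le> D" for y unfolding D_def by (rule cSUP_upper[OF _ bdd]) simp
  have D0: "0 \<le> D" using dD[of 0] by linarith
  have icdf: "integrable K (\<lambda>t. cdf \<mu> (y - t))" for y
    using \<mu>.cdf_nonneg \<mu>.cdf_bounded_prob
    by (intro integrable_bounded_real[OF K, of _ 1]) auto
  have iA: "integrable K (indicator A :: _ \<Rightarrow> real)"
    by (intro integrable_bounded_real[OF K, of _ 1]) (auto simp: indicator_def)
  have im: "integrable K ?m"
    by (intro integrable_bounded_real[OF K, of _ 1]) auto
  have intA: "(LINT t|K. (a * (1 - indicator A t) - D * indicator A t - ?m t)) = a * (1 - \<alpha>) - D * \<alpha> - T" for a
    using iA im by (simp add: \<alpha>_def T_def K.prob_space[simplified] right_diff_distrib)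
  have iall: "integrable K (\<lambda>t. a * (1 - indicator A t) - D * indicator A t - ?m t)" for a
    using iA im by simp
  have lip: "std_normal_cdf b - std_normal_cdf a \<le> ?m (b - a)" if "a \<le> b" for a b
    using std_normal_cdf_lipschitz[OF that] std_normal_cdf_bounds[of a] std_normal_cdf_bounds[of b] that
    by simp
  \<comment> \<open>Off \<open>A\<close>, F(y) \<le> F(y + \<epsilon> - t), and replacing Phi(y +
    \<epsilon>) by Phi(y) costs at most 41/100 \<epsilon>. On \<open>A\<close>, F(y + \<epsilon> -
    t) is at least Phi(y + \<epsilon> - t) - D, and removing the shift t from Phi costs
    \<open>?m t\<close>. Subtracting \<open>?m t\<close> off \<open>A\<close> as well lets its full
    integral \<open>T\<close> appear.\<close>
  have pos: "(?d y - 41 / 100 * \<epsilon>) * (1 - \<alpha>) - D * \<alpha> - T \<le> R" for y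
  proof -
    have pt: "(?d y - 41 / 100 * \<epsilon>) * (1 - indicator A t) - D * indicator A t - ?m t
        \<le> cdf \<mu> (y + \<epsilon> - t) - std_normal_cdf (y + \<epsilon>)" for t
    proof (cases "t \<in> A")
      case False
      then have "cdf \<mu> y \<le> cdf \<mu> (y + \<epsilon> - t)" by (intro \<mu>.cdf_nondecreasing) (auto simp: A_def)
      moreover have "0 \<le> ?m t" by simp
      ultimately show ?thesis using False std_normal_cdf_lipschitz[of y "y + \<epsilon>"] \<epsilon> by simp
    next
      case True
      have "std_normal_cdf (y + \<epsilon>) - std_normal_cdf (y + \<epsilon> - t) \<le> ?m t"
        using lip[of "y + \<epsilon> - t" "y + \<epsilon>"] std_normal_cdf_mono[of "y + \<epsilon>" "y + \<epsilon> - t"]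
        by (cases "0 \<le> t") auto
      then have "- D - ?m t \<le> cdf \<mu> (y + \<epsilon> - t) - std_normal_cdf (y + \<epsilon>)"
        using dD[of "y + \<epsilon> - t"] by linarith
      then show ?thesis using True by simp
    qed
    have "(?d y - 41 / 100 * \<epsilon>) * (1 - \<alpha>) - D * \<alpha> - T
        \<le> (LINT t|K. cdf \<mu> (y + \<epsilon> - t) - std_normal_cdf (y + \<epsilon>))"
      unfolding intA[symmetric] using pt icdf iall by (intro integral_mono) auto
    also have "\<dots> = (LINT t|K. cdf \<mu> (y + \<epsilon> - t)) - std_normal_cdf (y + \<epsilon>)"
      using icdf by (simp add: K.prob_space[simplified])
    finally show ?thesis using R[of "y + \<epsilon>"] by linarith
  qed
  \<comment> \<open>The mirror image: evaluation at y - \<epsilon> turns the monotonicity inequality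
    round.\<close>
  have neg: "(- ?d y - 41 / 100 * \<epsilon>) * (1 - \<alpha>) - D * \<alpha> - T \<le> R" for y
  proof -
    have pt: "(- ?d y - 41 / 100 * \<epsilon>) * (1 - indicator A t) - D * indicator A t - ?m t
        \<le> std_normal_cdf (y - \<epsilon>) - cdf \<mu> (y - \<epsilon> - t)" for t
    proof (cases "t \<in> A")
      case False
      then have "cdf \<mu> (y - \<epsilon> - t) \<le> cdf \<mu> y" by (intro \<mu>.cdf_nondecreasing) (auto simp: A_def)
      moreover have "0 \<le> ?m t" by simp
      ultimately show ?thesis using False std_normal_cdf_lipschitz[of "y - \<epsilon>" y] \<epsilon> by simp
    next
      case True
      have "std_normal_cdf (y - \<epsilon> - t) - std_normal_cdf (y - \<epsilon>) \<le> ?m t"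
        using lip[of "y - \<epsilon>" "y - \<epsilon> - t"] std_normal_cdf_mono[of "y - \<epsilon> - t" "y - \<epsilon>"]
        by (cases "t \<le> 0") auto
      then have "- D - ?m t \<le> std_normal_cdf (y - \<epsilon>) - cdf \<mu> (y - \<epsilon> - t)"
        using dD[of "y - \<epsilon> - t"] by linarith
      then show ?thesis using True by simp
    qed
    have "(- ?d y - 41 / 100 * \<epsilon>) * (1 - \<alpha>) - D * \<alpha> - T
        \<le> (LINT t|K. std_normal_cdf (y - \<epsilon>) - cdf \<mu> (y - \<epsilon> - t))"
      unfolding intA[symmetric] using pt icdf iall by (intro integral_mono) auto
    also have "\<dots> = std_normal_cdf (y - \<epsilon>) - (LINT t|K. cdf \<mu> (y - \<epsilon> - t))"
      using icdf by (simp add: K.prob_space[simplified])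
    finally show ?thesis using R[of "y - \<epsilon>"] by linarith
  qed
  have \<alpha>: "0 \<le> \<alpha>" "\<alpha> \<le> 1 / 7" using small by (simp_all add: \<alpha>_def A_def)
  have abs: "\<bar>?d y\<bar> \<le> (R + T + D * \<alpha>) / (1 - \<alpha>) + 41 / 100 * \<epsilon>" for y
  proof -
    have "(\<bar>?d y\<bar> - 41 / 100 * \<epsilon>) * (1 - \<alpha>) \<le> R + T + D * \<alpha>"
      using pos[of y] neg[of y] by (cases "0 \<le> ?d y") auto
    then have "\<bar>?d y\<bar> - 41 / 100 * \<epsilon> \<le> (R + T + D * \<alpha>) / (1 - \<alpha>)"
      using \<alpha> by (simp add: pos_le_divide_eq)
    then show ?thesis by simp
  qed
  \<comment> \<open>The bound is uniform in y and so passes to the supremum. As \<open>D\<close> is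
    finite, the \<open>D\<close> on the right can be absorbed.\<close>
  have "D \<le> (R + T + D * \<alpha>) / (1 - \<alpha>) + 41 / 100 * \<epsilon>"
    unfolding D_def[symmetric] by (subst (1) D_def, rule cSUP_least) (use abs in auto)
  then have main: "(D - 41 / 100 * \<epsilon>) * (1 - \<alpha>) \<le> R + T + D * \<alpha>"
    using \<alpha> by (simp add: field_simps)
  have "0 \<le> R" using R[of 0] by linarith
  moreover have "0 \<le> T" unfolding T_def by (intro integral_nonneg_AE) auto
  \<comment> \<open>Only when D exceeds 41/100 \<epsilon> may the factor 1 - \<alpha> be lowered to
    6/7. Then D (6/7 - 1/7) \<le> R + T + 6/7 * 41/100 \<epsilon>, and division by 5/7 gives the
    coefficients 7/5 and 6/5.\<close>
  moreover have "D \<le> 7 / 5 * (R + T) + 6 / 5 * (41 / 100 * \<epsilon>)"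
  proof (cases "D \<le> 41 / 100 * \<epsilon>")
    case True
    moreover have "41 / 100 * \<epsilon> \<le> 6 / 5 * (41 / 100 * \<epsilon>)" using \<epsilon> by simp
    moreover have "0 \<le> 7 / 5 * (R + T)" using \<open>0 \<le> R\<close> \<open>0 \<le> T\<close> by simp
    ultimately show ?thesis by linarith
  next
    case False
    have "(D - 41 / 100 * \<epsilon>) * (6 / 7) \<le> (D - 41 / 100 * \<epsilon>) * (1 - \<alpha>)"
      using False \<alpha> by (intro mult_left_mono) auto
    moreover have "D * \<alpha> \<le> D * (1 / 7)" using D0 \<alpha> by (intro mult_left_mono) auto
    ultimately have "(D - 41 / 100 * \<epsilon>) * (6 / 7) \<le> R + T + D * (1 / 7)"
      using main by linarith
    then show ?thesis by (simp add: field_simps)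
  qed
  ultimately show ?thesis using dD[of x] unfolding T_def by linarith
qed

text \<open>The probability of [x, x + z] is F(x + z) - F(x-), and each endpoint costs D; hence the
  factor 2. The upper bound uses that centered intervals maximize normal mass, the lower bound tests
  the centered window x = - z / 2.\<close>

lemma concentration_kolmogorov:
  assumes M: "prob_space M" and W [measurable]: "W \<in> borel_measurable M"
    and D: "\<And>x. \<bar>cdf (distr M borel W) x - std_normal_cdf x\<bar> \<le> D" and z: "0 \<le> z"
  shows "\<bar>concentration M W z - folded_normal_cdf (z / 2)\<bar> \<le> 2 * D"
proof -
  interpret prob_space M by fact
  interpret \<mu>: real_distribution "distr M borel W" by (rule real_distribution_distr) simp
  let ?\<mu> = "distr M borel W"
  \<comment> \<open>Closed windows involve the left limit of F. The distance bound survives the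
    limit from the left because Phi is continuous.\<close>
  have left: "\<bar>measure ?\<mu> {..<x} - std_normal_cdf x\<bar> \<le> D" for x
  proof (rule tendsto_upperbound)
    show "((\<lambda>y. \<bar>cdf ?\<mu> y - std_normal_cdf y\<bar>) \<longlongrightarrow> \<bar>measure ?\<mu> {..<x} - std_normal_cdf x\<bar>) (at_left x)"
      using isCont_std_normal(1)[of x] \<mu>.cdf_at_left[of x]
      by (intro tendsto_intros) (auto simp: isCont_def intro: filterlim_mono at_le)
  qed (use D in auto)
  have eq: "\<P>(\<omega> in M. x \<le> W \<omega> \<and> W \<omega> \<le> x + z) = cdf ?\<mu> (x + z) - measure ?\<mu> {..<x}" for x
  proof -
    have "cdf ?\<mu> (x + z) = measure ?\<mu> ({..<x} \<union> {x..x + z})"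
      unfolding cdf_def2 using z by (intro arg_cong[where f="measure ?\<mu>"]) auto
    also have "\<dots> = measure ?\<mu> {..<x} + measure ?\<mu> {x..x + z}"
      by (intro \<mu>.finite_measure_Union) auto
    also have "measure ?\<mu> {x..x + z} = \<P>(\<omega> in M. x \<le> W \<omega> \<and> W \<omega> \<le> x + z)"
      by (subst measure_distr) (auto intro!: arg_cong[where f=prob])
    finally show ?thesis by simp
  qed
  have close: "\<bar>\<P>(\<omega> in M. x \<le> W \<omega> \<and> W \<omega> \<le> x + z) - (std_normal_cdf (x + z) - std_normal_cdf x)\<bar> \<le> 2 * D" for x
    unfolding eq using left[of x] D[of "x + z"] by linarith
  have fold: "folded_normal_cdf (z / 2) = 2 * std_normal_cdf (z / 2) - 1"
    using z by (simp add: folded_normal_cdf_def)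
  have "concentration M W z \<le> folded_normal_cdf (z / 2) + 2 * D"
    unfolding concentration_def
  proof (rule cSUP_least)
    fix x show "\<P>(\<omega> in M. x \<le> W \<omega> \<and> W \<omega> \<le> x + z) \<le> folded_normal_cdf (z / 2) + 2 * D"
      using close[of x] std_normal_cdf_interval_le[OF z, of x] unfolding fold by linarith
  qed simp
  moreover have "\<P>(\<omega> in M. - z / 2 \<le> W \<omega> \<and> W \<omega> \<le> - z / 2 + z) \<le> concentration M W z"
    unfolding concentration_def by (rule cSUP_upper[OF _ bdd_above_concentration[OF M]]) simp
  moreover have "folded_normal_cdf (z / 2) - 2 * D \<le> \<P>(\<omega> in M. - z / 2 \<le> W \<omega> \<and> W \<omega> \<le> - z / 2 + z)"
    using close[of "- z / 2"] std_normal_cdf_minus[of "z / 2"] unfolding fold by simp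
  ultimately show ?thesis by linarith
qed

section \<open>Stein's identity for Poisson random sums\<close>

lemma abs_mult_bound:
  fixes a b B :: real
  assumes "\<bar>b\<bar> \<le> B"
  shows "\<bar>a * b\<bar> \<le> B * \<bar>a\<bar>" "\<bar>a * b\<bar> \<le> \<bar>B * a\<bar>"
proof -
  show "\<bar>a * b\<bar> \<le> B * \<bar>a\<bar>"
    using mult_right_mono[OF assms, of "\<bar>a\<bar>"] by (simp add: abs_mult mult.commute)
  moreover have "0 \<le> B" using assms by linarith
  ultimately show "\<bar>a * b\<bar> \<le> \<bar>B * a\<bar>" by (simp add: abs_mult)
qed

lemma (in prob_space) indep_var_integral:
  fixes h :: "real \<times> real \<Rightarrow> real"
  assumes ind: "indep_var borel Y borel Z" and h [measurable]: "h \<in> borel_measurable (borel \<Otimes>\<^sub>M borel)"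
    and int: "integrable M (\<lambda>\<omega>. h (Y \<omega>, Z \<omega>))"
  shows "(LINT \<omega>|M. h (Y \<omega>, Z \<omega>)) = (LINT y|distr M borel Y. LINT \<omega>|M. h (y, Z \<omega>))"
proof -
  have Y [measurable]: "Y \<in> borel_measurable M" and Z [measurable]: "Z \<in> borel_measurable M"
    using ind by (auto dest: indep_var_rv1 indep_var_rv2)
  interpret Y: real_distribution "distr M borel Y" by (rule real_distribution_distr) simp
  interpret Z: real_distribution "distr M borel Z" by (rule real_distribution_distr) simp
  interpret pair_sigma_finite "distr M borel Y" "distr M borel Z" ..
  have eq: "distr M borel Y \<Otimes>\<^sub>M distr M borel Z = distr M (borel \<Otimes>\<^sub>M borel) (\<lambda>\<omega>. (Y \<omega>, Z \<omega>))"
    using ind by (simp add: indep_var_distribution_eq)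
  have "(LINT y|distr M borel Y. LINT z|distr M borel Z. h (y, z)) = integral\<^sup>L (distr M borel Y \<Otimes>\<^sub>M distr M borel Z) h"
    using int by (intro integral_fst') (simp add: eq integrable_distr_eq)
  also have "\<dots> = (LINT \<omega>|M. h (Y \<omega>, Z \<omega>))"
    unfolding eq by (simp add: integral_distr)
  finally show ?thesis by (simp add: integral_distr)
qed

lemma integrable_pair_first:
  fixes f :: "'a \<Rightarrow> real"
  assumes "prob_space P" "prob_space Q" and f: "integrable P f"
  shows "integrable (P \<Otimes>\<^sub>M Q) (\<lambda>z. f (fst z))"
proof -
  interpret P: prob_space P by fact
  interpret Q: prob_space Q by fact
  have "integrable (distr (P \<Otimes>\<^sub>M Q) P fst) f" using f by (simp add: Q.distr_pair_fst)
  then show ?thesis by (subst (asm) integrable_distr_eq) (use f in auto)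
qed

section \<open>Poisson random sums with integrable summands: independence, size biasing and mixing
  over the count\<close>

locale poisson_random_sum = prob_space M for M :: "'a measure" +
  fixes X :: "nat \<Rightarrow> 'a \<Rightarrow> real" and N :: "'a \<Rightarrow> nat" and lambda :: real
  assumes indep: "jointly_indep M N X"
    and identical: "distr M borel (X n) = distr M borel (X 0)"
    and integrable_X0: "integrable M (X 0)"
    and lambda_pos: "0 < lambda"
    and poisson: "distr M (count_space UNIV) N = measure_pmf (poisson_pmf lambda)"
begin

abbreviation "P \<equiv> distr M borel (X 0)"
abbreviation "S n \<omega> \<equiv> (\<Sum>i<n. X i \<omega>)"
abbreviation "W \<equiv> random_sum X N"

lemma measurable_X [measurable]: "X n \<in> borel_measurable M"
  using indep unfolding jointly_indep_def indep_vars_def by (auto dest: spec[of _ "Some n"])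

lemma measurable_N [measurable]: "N \<in> measurable M (count_space UNIV)"
proof -
  have [measurable]: "(\<lambda>\<omega>. real (N \<omega>)) \<in> borel_measurable M"
    using indep unfolding jointly_indep_def indep_vars_def by (auto dest: spec[of _ "None"])
  have "(\<lambda>\<omega>. nat \<lfloor>real (N \<omega>)\<rfloor>) \<in> measurable M (count_space UNIV)" by measurable
  then show ?thesis by simp
qed

lemma measurable_W [measurable]: "W \<in> borel_measurable M"
proof -
  have "(\<lambda>\<omega>. S (N \<omega>) \<omega>) \<in> borel_measurable M"
    by (rule measurable_compose_countable[where f = S]) measurable
  then show ?thesis by (simp add: random_sum_def[abs_def])
qed

lemma real_distribution_P: "real_distribution P"
  by (rule real_distribution_distr) simp

lemma indep_X_S: "indep_var borel (X n) borel (S n)"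
proof -
  let ?F = "case_option (\<lambda>\<omega>. real (N \<omega>)) X"
  have "indep_var borel (?F (Some n)) borel (\<lambda>\<omega>. \<Sum>i\<in>Some ` {..<n}. ?F i \<omega>)"
    using indep unfolding jointly_indep_def
    by (intro indep_vars_sum) (auto intro: indep_vars_subset)
  then show ?thesis by (simp add: sum.reindex)
qed

lemma indep_N_S: "indep_var borel (\<lambda>\<omega>. real (N \<omega>)) borel (S n)"
proof -
  let ?F = "case_option (\<lambda>\<omega>. real (N \<omega>)) X"
  have "indep_var borel (?F None) borel (\<lambda>\<omega>. \<Sum>i\<in>Some ` {..<n}. ?F i \<omega>)"
    using indep unfolding jointly_indep_def
    by (intro indep_vars_sum) (auto intro: indep_vars_subset)
  then show ?thesis by (simp add: sum.reindex)
qed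

lemma integrable_X: "integrable M (X n)"
proof -
  have "integrable (distr M borel (X n)) (\<lambda>x. x)"
    unfolding identical[of n] using integrable_X0 by (simp add: integrable_distr_eq)
  then show ?thesis by (simp add: integrable_distr_eq)
qed

lemma integrable_S: "integrable M (S n)"
  by (intro Bochner_Integration.integrable_sum integrable_X)

lemma expectation_abs_S_le: "expectation (\<lambda>\<omega>. \<bar>S n \<omega>\<bar>) \<le> real n * expectation (\<lambda>\<omega>. \<bar>X 0 \<omega>\<bar>)"
proof -
  have "expectation (\<lambda>\<omega>. \<bar>X i \<omega>\<bar>) = (LINT x|distr M borel (X i). \<bar>x\<bar>)" for i
    by (simp add: integral_distr)
  then have same: "expectation (\<lambda>\<omega>. \<bar>X i \<omega>\<bar>) = expectation (\<lambda>\<omega>. \<bar>X 0 \<omega>\<bar>)" for i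
    using identical[of i] by metis
  have "expectation (\<lambda>\<omega>. \<bar>S n \<omega>\<bar>) \<le> expectation (\<lambda>\<omega>. \<Sum>i<n. \<bar>X i \<omega>\<bar>)"
    using integrable_S integrable_X
    by (intro integral_mono) (auto intro!: Bochner_Integration.integrable_sum integrable_abs)
  also have "\<dots> = (\<Sum>i<n. expectation (\<lambda>\<omega>. \<bar>X i \<omega>\<bar>))"
    using integrable_X by (intro Bochner_Integration.integral_sum) auto
  also have "\<dots> = (\<Sum>i<n. expectation (\<lambda>\<omega>. \<bar>X 0 \<omega>\<bar>))" by (rule sum.cong[OF refl same])
  finally show ?thesis by simp
qed

text \<open>The mean of X g(w + X) for a fresh summand X added at position w: the operator on the
  right-hand side of the Stein identity of a compound Poisson sum.\<close>

definition jump_mean :: "(real \<Rightarrow> real) \<Rightarrow> real \<Rightarrow> real" where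
  "jump_mean g w = (LINT y|P. y * g (w + y))"

context
  fixes g :: "real \<Rightarrow> real" and B :: real
  assumes g [measurable]: "g \<in> borel_measurable borel" and bound: "\<And>x. \<bar>g x\<bar> \<le> B"
begin

lemma integrable_jump: "integrable P (\<lambda>y. y * g (w + y))"
proof (rule Bochner_Integration.integrable_bound)
  show "integrable P (\<lambda>y. B * y)" using integrable_X0 by (simp add: integrable_distr_eq)
  show "AE y in P. norm (y * g (w + y)) \<le> norm (B * y)"
    using abs_mult_bound(2)[OF bound] by (intro AE_I2) simp
qed simp

lemma measurable_jump_mean [measurable]: "jump_mean g \<in> borel_measurable borel"
proof -
  interpret P: real_distribution P by (rule real_distribution_P)
  have "(\<lambda>w. LINT y|P. y * g (w + y)) \<in> borel_measurable borel" by measurable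
  then show ?thesis by (simp add: jump_mean_def[abs_def])
qed

lemma jump_mean_bound: "\<bar>jump_mean g w\<bar> \<le> B * expectation (\<lambda>\<omega>. \<bar>X 0 \<omega>\<bar>)"
proof -
  have "\<bar>jump_mean g w\<bar> \<le> (LINT y|P. \<bar>y * g (w + y)\<bar>)"
    unfolding jump_mean_def by (rule integral_abs_bound)
  also have "\<dots> \<le> (LINT y|P. B * \<bar>y\<bar>)"
  proof (rule integral_mono)
    show "\<bar>y * g (w + y)\<bar> \<le> B * \<bar>y\<bar>" for y
      by (rule abs_mult_bound(1)[OF bound])
    show "integrable P (\<lambda>y. B * \<bar>y\<bar>)" using integrable_X0 by (simp add: integrable_distr_eq)
  qed (simp add: integrable_jump)
  finally show ?thesis by (simp add: integral_distr)
qed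

lemma fubini_jump_mean:
  assumes [measurable]: "Z \<in> borel_measurable M"
  shows "(LINT y|P. expectation (\<lambda>\<omega>. y * g (Z \<omega> + y))) = expectation (\<lambda>\<omega>. jump_mean g (Z \<omega>))"
proof -
  interpret P: real_distribution P by (rule real_distribution_P)
  interpret pair_sigma_finite P M ..
  have "integrable (P \<Otimes>\<^sub>M M) (\<lambda>(y, \<omega>). y * g (Z \<omega> + y))"
  proof (rule Bochner_Integration.integrable_bound)
    have "integrable P (\<lambda>y. B * y)" using integrable_X0 by (simp add: integrable_distr_eq)
    then show "integrable (P \<Otimes>\<^sub>M M) (\<lambda>z. B * fst z)"
      by (intro integrable_pair_first P.prob_space_axioms prob_space_axioms)
    show "AE z in P \<Otimes>\<^sub>M M. norm ((\<lambda>(y, \<omega>). y * g (Z \<omega> + y)) z) \<le> norm (B * fst z)"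
      using abs_mult_bound(2)[OF bound] by (intro AE_I2) (simp add: split_beta)
  qed measurable
  from Fubini_integral[OF this] show ?thesis by (simp add: jump_mean_def)
qed

end

lemma expectation_S_Suc:
  fixes h :: "real \<Rightarrow> real"
  assumes [measurable]: "h \<in> borel_measurable borel" and int: "integrable M (\<lambda>\<omega>. h (S (Suc n) \<omega>))"
  shows "expectation (\<lambda>\<omega>. h (S (Suc n) \<omega>)) = (LINT y|P. expectation (\<lambda>\<omega>. h (S n \<omega> + y)))"
  using indep_var_integral[OF indep_X_S[of n], of "\<lambda>(y, s). h (s + y)"] int
  by (simp add: identical[of n])

text \<open>Morally, each of the n + 1 exchangeable summands contributes the same term, with the
  other n forming \<open>S n\<close>. The proof is by induction, splitting off the last summand y:
  its own term gives one jump mean, and the induction hypothesis for g shifted by y, whence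
  \<open>g\<close> is arbitrary, gives the remaining n + 1.\<close>

lemma size_bias_S:
  assumes "g \<in> borel_measurable borel" "\<And>x. \<bar>g x\<bar> \<le> B"
  shows "expectation (\<lambda>\<omega>. S (Suc n) \<omega> * g (S (Suc n) \<omega>)) = real (Suc n) * expectation (\<lambda>\<omega>. jump_mean g (S n \<omega>))"
  using assms
proof (induction n arbitrary: g)
  case 0
  then show ?case by (simp add: jump_mean_def integral_distr prob_space)
next
  case (Suc n)
  note [measurable] = Suc.prems(1)
  note b = Suc.prems(2)
  have intg: "integrable M (\<lambda>\<omega>. S k \<omega> * g (S k \<omega> + y))" for k y
  proof (rule Bochner_Integration.integrable_bound)
    show "integrable M (\<lambda>\<omega>. B * S k \<omega>)" using integrable_S by simp
    show "AE \<omega> in M. norm (S k \<omega> * g (S k \<omega> + y)) \<le> norm (B * S k \<omega>)"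
      using abs_mult_bound(2)[OF b] by (intro AE_I2) (simp del: sum.lessThan_Suc)
  qed simp
  have intb: "integrable M (\<lambda>\<omega>. g (S k \<omega> + y))" for k y
    using b by (intro integrable_const_bound[where B = B]) auto
  \<comment> \<open>The jump mean of the shifted function x \<mapsto> g(x + y) at s is the jump mean
    of g at s + y.\<close>
  have shift: "expectation (\<lambda>\<omega>. S (Suc n) \<omega> * g (S (Suc n) \<omega> + y))
      = real (Suc n) * expectation (\<lambda>\<omega>. jump_mean g (S n \<omega> + y))" for y
    using Suc.IH[of "\<lambda>x. g (x + y)"] b by (simp add: jump_mean_def add_ac)
  note mj [measurable] = measurable_jump_mean[OF Suc.prems]
  have intj: "integrable M (\<lambda>\<omega>. jump_mean g (S k \<omega>))" for k
    using jump_mean_bound[OF Suc.prems] by (intro integrable_const_bound) auto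
  let ?a = "\<lambda>y. expectation (\<lambda>\<omega>. jump_mean g (S n \<omega> + y))"
    and ?b = "\<lambda>y. expectation (\<lambda>\<omega>. y * g (S (Suc n) \<omega> + y))"
  have ia: "integrable P ?a"
  proof (rule integrable_bounded_real[OF real_distribution_P])
    show "?a \<in> borel_measurable borel" by measurable
    show "\<bar>?a y\<bar> \<le> B * expectation (\<lambda>\<omega>. \<bar>X 0 \<omega>\<bar>)" for y
    proof -
      have "\<bar>?a y\<bar> \<le> expectation (\<lambda>\<omega>. \<bar>jump_mean g (S n \<omega> + y)\<bar>)" by (rule integral_abs_bound)
      also have "\<dots> \<le> expectation (\<lambda>\<omega>. B * expectation (\<lambda>\<omega>. \<bar>X 0 \<omega>\<bar>))"
      proof (rule integral_mono)
        show "integrable M (\<lambda>\<omega>. \<bar>jump_mean g (S n \<omega> + y)\<bar>)"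
          by (rule integrable_const_bound[where B = "B * expectation (\<lambda>\<omega>. \<bar>X 0 \<omega>\<bar>)"])
            (use jump_mean_bound[OF Suc.prems] in auto)
      qed (use jump_mean_bound[OF Suc.prems] in auto)
      finally show ?thesis by (simp add: prob_space)
    qed
  qed
  have ib: "integrable P ?b"
  proof (rule Bochner_Integration.integrable_bound)
    show "integrable P (\<lambda>y. B * y)" using integrable_X0 by (simp add: integrable_distr_eq)
    have "\<bar>?b y\<bar> \<le> \<bar>B * y\<bar>" for y
    proof -
      have "\<bar>?b y\<bar> \<le> expectation (\<lambda>\<omega>. \<bar>y * g (S (Suc n) \<omega> + y)\<bar>)" by (rule integral_abs_bound)
      also have "\<dots> \<le> expectation (\<lambda>\<omega>. \<bar>B * y\<bar>)"
        using abs_mult_bound(2)[OF b] intb[of "Suc n" y]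
        by (intro integral_mono integrable_abs integrable_mult_right) auto
      finally show ?thesis by (simp add: prob_space)
    qed
    then show "AE y in P. norm (?b y) \<le> norm (B * y)" by simp
  qed measurable
  have "expectation (\<lambda>\<omega>. S (Suc (Suc n)) \<omega> * g (S (Suc (Suc n)) \<omega>))
      = (LINT y|P. expectation (\<lambda>\<omega>. (S (Suc n) \<omega> + y) * g (S (Suc n) \<omega> + y)))"
    using intg[of "Suc (Suc n)" 0] by (intro expectation_S_Suc[where h="\<lambda>x. x * g x"]) simp_all
  also have "\<dots> = (LINT y|P. real (Suc n) * ?a y + ?b y)"
  proof (intro Bochner_Integration.integral_cong refl)
    fix y
    have "expectation (\<lambda>\<omega>. (S (Suc n) \<omega> + y) * g (S (Suc n) \<omega> + y))
      = expectation (\<lambda>\<omega>. S (Suc n) \<omega> * g (S (Suc n) \<omega> + y)) + ?b y"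
      using intg[of "Suc n" y] intb[of "Suc n" y]
      by (subst Bochner_Integration.integral_add[symmetric]) (auto simp: distrib_right)
    then show "expectation (\<lambda>\<omega>. (S (Suc n) \<omega> + y) * g (S (Suc n) \<omega> + y)) = real (Suc n) * ?a y + ?b y"
      by (simp only: shift)
  qed
  also have "\<dots> = real (Suc n) * (LINT y|P. ?a y) + (LINT y|P. ?b y)"
    using ia ib by simp
  \<comment> \<open>Averaging over y restores the split-off summand, so both integrals become the
    same mean at \<open>S (Suc n)\<close> and the factors n + 1 and 1 add up.\<close>
  also have "(LINT y|P. ?a y) = expectation (\<lambda>\<omega>. jump_mean g (S (Suc n) \<omega>))"
    using intj[of "Suc n"] by (intro expectation_S_Suc[symmetric]) auto
  also have "(LINT y|P. ?b y) = expectation (\<lambda>\<omega>. jump_mean g (S (Suc n) \<omega>))"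
    by (intro fubini_jump_mean[OF Suc.prems]) simp
  finally show ?case by (simp only: of_nat_Suc) (simp add: algebra_simps)
qed

text \<open>h(W) is the sum over n of 1_{N = n} h(S n), with one nonzero term at each point.
  Independence of N and S n factors each mean, and summability of the absolute means justifies
  exchanging sum and expectation.\<close>

lemma sums_expectation_W:
  assumes [measurable]: "h \<in> borel_measurable borel"
    and int: "\<And>n. integrable M (\<lambda>\<omega>. h (S n \<omega>))"
    and summ: "summable (\<lambda>n. pmf (poisson_pmf lambda) n * expectation (\<lambda>\<omega>. \<bar>h (S n \<omega>)\<bar>))"
  shows "integrable M (\<lambda>\<omega>. h (W \<omega>))"
    and "(\<lambda>n. pmf (poisson_pmf lambda) n * expectation (\<lambda>\<omega>. h (S n \<omega>))) sums expectation (\<lambda>\<omega>. h (W \<omega>))"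
proof -
  \<comment> \<open>The event N = n is expressed through \<open>real (N \<omega>)\<close>, the
    variable whose independence \<open>jointly_indep\<close> provides.\<close>
  let ?I = "\<lambda>n \<omega>. indicator {real n} (real (N \<omega>)) :: real"
  let ?f = "\<lambda>n \<omega>. ?I n \<omega> * h (S n \<omega>)"
  have p: "expectation (?I n) = pmf (poisson_pmf lambda) n" for n
  proof -
    have "pmf (poisson_pmf lambda) n = measure (distr M (count_space UNIV) N) {n}"
      unfolding poisson by (simp add: measure_pmf_single)
    also have "\<dots> = (LINT k|distr M (count_space UNIV) N. indicator {n} k)" by simp
    also have "\<dots> = expectation (\<lambda>\<omega>. indicator {n} (N \<omega>))" by (rule integral_distr) auto
    also have "\<dots> = expectation (?I n)"
      by (intro Bochner_Integration.integral_cong refl) (auto simp: indicator_def)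
    finally show ?thesis by simp
  qed
  have iI: "integrable M (?I n)" for n
    by (intro integrable_const_bound[where B=1]) (auto simp: indicator_def)
  have prod: "integrable M (\<lambda>\<omega>. ?I n \<omega> * k (S n \<omega>))"
    "expectation (\<lambda>\<omega>. ?I n \<omega> * k (S n \<omega>)) = pmf (poisson_pmf lambda) n * expectation (\<lambda>\<omega>. k (S n \<omega>))"
    if k: "k \<in> borel_measurable borel" "integrable M (\<lambda>\<omega>. k (S n \<omega>))" for n and k :: "real \<Rightarrow> real"
  proof -
    have "indep_var borel ((indicator {real n} :: real \<Rightarrow> real) \<circ> (\<lambda>\<omega>. real (N \<omega>))) borel (k \<circ> S n)"
      using k by (intro indep_var_compose[OF indep_N_S]) auto
    then have ind: "indep_var borel (?I n) borel (\<lambda>\<omega>. k (S n \<omega>))" by (simp add: comp_def)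
    show "integrable M (\<lambda>\<omega>. ?I n \<omega> * k (S n \<omega>))"
      by (rule indep_var_integrable[OF ind iI k(2)])
    show "expectation (\<lambda>\<omega>. ?I n \<omega> * k (S n \<omega>)) = pmf (poisson_pmf lambda) n * expectation (\<lambda>\<omega>. k (S n \<omega>))"
      using indep_var_lebesgue_integral[OF ind iI k(2)] p by simp
  qed
  have sums: "(\<lambda>n. ?f n \<omega>) sums h (W \<omega>)" for \<omega>
  proof -
    have "(\<lambda>n. ?f n \<omega>) = (\<lambda>n. if n = N \<omega> then h (S n \<omega>) else 0)" by (auto simp: indicator_def)
    then show ?thesis using sums_single[of "N \<omega>" "\<lambda>n. h (S n \<omega>)"] by (simp add: random_sum_def)
  qed
  have norm: "norm (?f n \<omega>) = ?I n \<omega> * \<bar>h (S n \<omega>)\<bar>" for n \<omega> by (simp add: abs_mult)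
  have sumn: "summable (\<lambda>n. norm (?f n \<omega>))" for \<omega>
    by (rule summable_finite[of "{N \<omega>}"]) (auto simp: indicator_def)
  have intf: "integrable M (?f n)" for n by (rule prod(1)) (use int in auto)
  have sumE: "summable (\<lambda>n. expectation (\<lambda>\<omega>. norm (?f n \<omega>)))"
    unfolding norm using summ int prod(2)[of "\<lambda>x. \<bar>h x\<bar>"] by simp
  have eqW: "(\<lambda>\<omega>. \<Sum>n. ?f n \<omega>) = (\<lambda>\<omega>. h (W \<omega>))" using sums by (auto simp: sums_iff)
  show "integrable M (\<lambda>\<omega>. h (W \<omega>))"
    using integrable_suminf[OF intf _ sumE] sumn unfolding eqW by simp
  have "(\<lambda>n. expectation (?f n)) sums expectation (\<lambda>\<omega>. \<Sum>n. ?f n \<omega>)"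
    using sums_integral[OF intf _ sumE] sumn by simp
  then show "(\<lambda>n. pmf (poisson_pmf lambda) n * expectation (\<lambda>\<omega>. h (S n \<omega>))) sums expectation (\<lambda>\<omega>. h (W \<omega>))"
    unfolding eqW using prod(2)[of h] int by simp
qed

text \<open>This recursion is where the Poisson law enters: it turns the factor n + 1 from size
  biasing into the constant lambda and lowers the index by one.\<close>

lemma pmf_poisson_Suc:
  "pmf (poisson_pmf lambda) (Suc n) * real (Suc n) = lambda * pmf (poisson_pmf lambda) n"
  using lambda_pos by (simp add: field_simps del: of_nat_Suc)

lemma summable_pmf_poisson: "summable (pmf (poisson_pmf lambda))"
proof -
  have "summable (\<lambda>n. inverse (fact n) * lambda ^ n * exp (- lambda))"
    by (intro summable_mult2 summable_exp)
  also have "(\<lambda>n. inverse (fact n) * lambda ^ n * exp (- lambda)) = pmf (poisson_pmf lambda)"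
    using lambda_pos by (auto simp: field_simps)
  finally show ?thesis .
qed

text \<open>In the series for E(W g(W)) the term n = 0 vanishes because S 0 = 0. Size biasing and
  the Poisson recursion turn the term n + 1 into lambda times the n-th term of the series for the
  mean of \<open>jump_mean g (W \<omega>)\<close>; uniqueness of sums concludes.\<close>

lemma stein_identity_W:
  assumes g [measurable]: "g \<in> borel_measurable borel" and b: "\<And>x. \<bar>g x\<bar> \<le> B"
  shows "integrable M W"
    and "expectation (\<lambda>\<omega>. W \<omega> * g (W \<omega>)) = lambda * expectation (\<lambda>\<omega>. jump_mean g (W \<omega>))"
proof -
  let ?p = "pmf (poisson_pmf lambda)"
  have summ1: "summable (\<lambda>n. ?p n * expectation (\<lambda>\<omega>. \<bar>h (S n \<omega>)\<bar>))"
    if int: "\<And>n. integrable M (\<lambda>\<omega>. h (S n \<omega>))" and h: "\<And>x. \<bar>h x\<bar> \<le> C * \<bar>x\<bar>" for h C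
  proof -
    let ?E = "expectation (\<lambda>\<omega>. \<bar>X 0 \<omega>\<bar>)"
    have C: "0 \<le> C" using h[of 1] by simp
    \<comment> \<open>The mean of |S n| grows at most linearly in n. After the index shift the
      Poisson recursion absorbs this factor, leaving a multiple of the Poisson weights.\<close>
    have "summable (\<lambda>n. ?p (Suc n) * expectation (\<lambda>\<omega>. \<bar>h (S (Suc n) \<omega>)\<bar>))"
    proof (rule summable_comparison_test[of _ "\<lambda>n. ?p n * (lambda * C * ?E)"], intro exI allI impI)
      fix n
      have "expectation (\<lambda>\<omega>. \<bar>h (S (Suc n) \<omega>)\<bar>) \<le> expectation (\<lambda>\<omega>. C * \<bar>S (Suc n) \<omega>\<bar>)"
        using int[of "Suc n"] h integrable_S[of "Suc n"] by (intro integral_mono) auto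
      also have "\<dots> \<le> C * (real (Suc n) * ?E)"
        using expectation_abs_S_le[of "Suc n"] C by (simp add: mult_left_mono)
      finally have "?p (Suc n) * expectation (\<lambda>\<omega>. \<bar>h (S (Suc n) \<omega>)\<bar>) \<le> ?p (Suc n) * (C * (real (Suc n) * ?E))"
        by (rule mult_left_mono) simp
      also have "\<dots> = ?p (Suc n) * real (Suc n) * (C * ?E)" by (simp only: mult_ac)
      also have "\<dots> = ?p n * (lambda * C * ?E)" unfolding pmf_poisson_Suc by (simp only: mult_ac)
      finally show "norm (?p (Suc n) * expectation (\<lambda>\<omega>. \<bar>h (S (Suc n) \<omega>)\<bar>)) \<le> ?p n * (lambda * C * ?E)"
        by (simp add: abs_mult)
    qed (intro summable_mult2 summable_pmf_poisson)
    then show ?thesis by (subst (asm) summable_Suc_iff)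
  qed
  show "integrable M W"
    using sums_expectation_W(1)[of "\<lambda>x. x", OF _ _ summ1[of _ 1]] integrable_S by simp
  have intg: "integrable M (\<lambda>\<omega>. S n \<omega> * g (S n \<omega>))" for n
  proof (rule Bochner_Integration.integrable_bound)
    show "integrable M (\<lambda>\<omega>. B * S n \<omega>)" using integrable_S by simp
    show "AE \<omega> in M. norm (S n \<omega> * g (S n \<omega>)) \<le> norm (B * S n \<omega>)"
      using abs_mult_bound(2)[OF b] by (intro AE_I2) (simp del: sum.lessThan_Suc)
  qed simp
  have "(\<lambda>n. ?p n * expectation (\<lambda>\<omega>. S n \<omega> * g (S n \<omega>))) sums expectation (\<lambda>\<omega>. W \<omega> * g (W \<omega>))"
    by (rule sums_expectation_W(2)[of "\<lambda>x. x * g x", OF _ _ summ1[of _ B]])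
      (use intg abs_mult_bound(1)[OF b] in auto)
  then have "(\<lambda>n. ?p (Suc n) * expectation (\<lambda>\<omega>. S (Suc n) \<omega> * g (S (Suc n) \<omega>))) sums expectation (\<lambda>\<omega>. W \<omega> * g (W \<omega>))"
    by (subst sums_Suc_iff) simp
  also have "(\<lambda>n. ?p (Suc n) * expectation (\<lambda>\<omega>. S (Suc n) \<omega> * g (S (Suc n) \<omega>)))
    = (\<lambda>n. lambda * (?p n * expectation (\<lambda>\<omega>. jump_mean g (S n \<omega>))))"
    unfolding size_bias_S[OF g b] mult.assoc[symmetric] pmf_poisson_Suc ..
  finally have 1: "(\<lambda>n. lambda * (?p n * expectation (\<lambda>\<omega>. jump_mean g (S n \<omega>)))) sums expectation (\<lambda>\<omega>. W \<omega> * g (W \<omega>))" .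
  note mj [measurable] = measurable_jump_mean[OF g b]
  let ?C = "B * expectation (\<lambda>\<omega>. \<bar>X 0 \<omega>\<bar>)"
  have intj: "integrable M (\<lambda>\<omega>. jump_mean g (S k \<omega>))" for k
    using jump_mean_bound[OF g b] by (intro integrable_const_bound) auto
  have "(\<lambda>n. ?p n * expectation (\<lambda>\<omega>. jump_mean g (S n \<omega>))) sums expectation (\<lambda>\<omega>. jump_mean g (W \<omega>))"
  proof (rule sums_expectation_W(2)[OF mj intj])
    show "summable (\<lambda>n. ?p n * expectation (\<lambda>\<omega>. \<bar>jump_mean g (S n \<omega>)\<bar>))"
    proof (rule summable_comparison_test[of _ "\<lambda>n. ?p n * ?C"], intro exI allI impI)
      fix n
      have "expectation (\<lambda>\<omega>. \<bar>jump_mean g (S n \<omega>)\<bar>) \<le> expectation (\<lambda>\<omega>. ?C)"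
        using intj[of n] jump_mean_bound[OF g b] by (intro integral_mono) auto
      then show "norm (?p n * expectation (\<lambda>\<omega>. \<bar>jump_mean g (S n \<omega>)\<bar>)) \<le> ?p n * ?C"
        by (simp add: abs_mult prob_space mult_left_mono)
    qed (intro summable_mult2 summable_pmf_poisson)
  qed
  from sums_mult[OF this, of lambda] 1
  show "expectation (\<lambda>\<omega>. W \<omega> * g (W \<omega>)) = lambda * expectation (\<lambda>\<omega>. jump_mean g (W \<omega>))"
    by (rule sums_unique2[symmetric])
qed

end

section \<open>The zero-bias transform\<close>

text \<open>The increment is y times the average of the derivative over the segment from w to w + y;
  this average is the source of the uniform variable U. For y \<noteq> 0 the segment can meet the
  kink only at u = (x - w) / y, the exceptional point below.\<close>

lemma stein_sol_increment:
  "stein_sol x (w + y) - stein_sol x w = y * (LINT u:{0..1}|lborel. stein_rhs x (w + u * y))"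
proof (cases "y = 0")
  case False
  have "((\<lambda>u. y * stein_rhs x (w + u * y)) has_integral (stein_sol x (w + 1 * y) - stein_sol x (w + 0 * y))) {0..1}"
  proof (rule fundamental_theorem_of_calculus_strong[of "{(x - w) / y}"])
    fix u assume "u \<in> {0..1} - {(x - w) / y}"
    then have "w + u * y \<noteq> x" using False by (auto simp: field_simps)
    moreover have "DERIV (\<lambda>u. w + u * y) u :> y" by (auto intro!: derivative_eq_intros)
    ultimately have "DERIV (\<lambda>u. stein_sol x (w + u * y)) u :> stein_rhs x (w + u * y) * y"
      by (intro DERIV_chain2[where f = "stein_sol x"] DERIV_stein_sol)
    then show "((\<lambda>u. stein_sol x (w + u * y)) has_vector_derivative y * stein_rhs x (w + u * y)) (at u)"
      by (simp add: mult.commute flip: has_real_derivative_iff_has_vector_derivative)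
  next
    show "continuous_on {0..1} (\<lambda>u. stein_sol x (w + u * y))"
      by (rule continuous_on_compose2[OF continuous_on_stein_sol[of UNIV]]) (auto intro!: continuous_intros)
  qed auto
  moreover have si: "set_integrable lborel {0..1} (\<lambda>u. y * stein_rhs x (w + u * y))"
    unfolding set_integrable_def
  proof (rule integrableI_bounded_set_indicator[where B = "\<bar>y\<bar>"])
    show "AE u in lborel. u \<in> {0..1} \<longrightarrow> norm (y * stein_rhs x (w + u * y)) \<le> \<bar>y\<bar>"
      using mult_left_mono[OF abs_stein_rhs_le, of "\<bar>y\<bar>"] by (auto simp: abs_mult)
  qed auto
  ultimately have "(LINT u:{0..1}|lborel. y * stein_rhs x (w + u * y)) = stein_sol x (w + 1 * y) - stein_sol x (w + 0 * y)"
    unfolding set_borel_integral_eq_integral(2)[OF si] by (intro integral_unique)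
  then show ?thesis by simp
qed simp

definition uniform01 :: "real measure" where
  "uniform01 = density lborel (\<lambda>u. ennreal (indicator {0..1} u))"

lemma real_distribution_uniform01: "real_distribution uniform01"
proof -
  have "emeasure uniform01 (space uniform01) = 1"
    by (simp add: uniform01_def emeasure_density ennreal_indicator)
  then have "prob_space uniform01" by (rule prob_spaceI)
  then show ?thesis by (simp add: real_distribution_def real_distribution_axioms_def uniform01_def)
qed

lemma integral_uniform01:
  "h \<in> borel_measurable borel \<Longrightarrow> (LINT u|uniform01. h u) = (LINT u:{0..1}|lborel. h u :: real)"
  by (simp add: uniform01_def integral_density set_lebesgue_integral_def)

section \<open>The sum with unit variance and the law of its independent perturbation T\<close>

locale standardized_poisson_sum = poisson_random_sum +
  assumes integrable_sq: "integrable M (\<lambda>\<omega>. (X 0 \<omega>)\<^sup>2)"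
    and mean_zero: "expectation (X 0) = 0"
    and unit_variance: "lambda * expectation (\<lambda>\<omega>. (X 0 \<omega>)\<^sup>2) = 1"
begin

definition truncated_moment :: real where
  "truncated_moment = lambda * expectation (\<lambda>\<omega>. (X 0 \<omega>)\<^sup>2 * min 1 \<bar>X 0 \<omega>\<bar>)"

text \<open>The law of Z. The weight is quadratic, and \<open>unit_variance\<close> is exactly the
  condition that makes the total mass 1.\<close>

definition size_biased :: "real measure" where
  "size_biased = density P (\<lambda>y. ennreal (lambda * y\<^sup>2))"

definition zero_bias_jump :: "real measure" where
  "zero_bias_jump = distr (size_biased \<Otimes>\<^sub>M uniform01) borel (\<lambda>(y, u). u * y)"

lemma integrable_P_sq: "integrable P (\<lambda>y. y\<^sup>2)"
  using integrable_sq by (simp add: integrable_distr_eq)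

lemma integral_P_sq: "lambda * (LINT y|P. y\<^sup>2) = 1"
  using unit_variance by (simp add: integral_distr)

lemma real_distribution_size_biased: "real_distribution size_biased"
proof -
  have "emeasure size_biased (space size_biased) = (\<integral>\<^sup>+y. ennreal (lambda * y\<^sup>2) \<partial>P)"
    by (simp add: size_biased_def emeasure_density)
  also have "\<dots> = ennreal (LINT y|P. lambda * y\<^sup>2)"
    using integrable_P_sq lambda_pos by (intro nn_integral_eq_integral) auto
  also have "\<dots> = 1" using integral_P_sq by simp
  finally have "prob_space size_biased" by (rule prob_spaceI)
  then show ?thesis by (simp add: real_distribution_def real_distribution_axioms_def size_biased_def)
qed

lemma real_distribution_zero_bias_jump: "real_distribution zero_bias_jump"
proof -
  interpret V: real_distribution uniform01 by (rule real_distribution_uniform01)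
  interpret Z: real_distribution size_biased by (rule real_distribution_size_biased)
  interpret pair_prob_space size_biased uniform01 ..
  note [measurable_cong] = V.events_eq_borel Z.events_eq_borel
  show ?thesis unfolding zero_bias_jump_def by (rule real_distribution_distr) measurable
qed

lemma integral_zero_bias_jump:
  assumes h [measurable]: "h \<in> borel_measurable borel" and bound: "\<And>x. \<bar>h x\<bar> \<le> B"
  shows "(LINT t|zero_bias_jump. h t) = (LINT y|P. lambda * y\<^sup>2 * (LINT u:{0..1}|lborel. h (u * y)))"
proof -
  interpret V: real_distribution uniform01 by (rule real_distribution_uniform01)
  interpret Z: real_distribution size_biased by (rule real_distribution_size_biased)
  interpret VZ: pair_prob_space size_biased uniform01 ..
  note [measurable_cong] = V.events_eq_borel Z.events_eq_borel
  have "(LINT t|zero_bias_jump. h t) = (LINT z|(size_biased \<Otimes>\<^sub>M uniform01). h (case z of (y, u) \<Rightarrow> u * y))"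
    unfolding zero_bias_jump_def by (rule integral_distr) measurable
  also have "\<dots> = (LINT y|size_biased. LINT u|uniform01. h (u * y))"
  proof (subst VZ.integral_fst'[symmetric])
    show "integrable (size_biased \<Otimes>\<^sub>M uniform01) (\<lambda>z. h (case z of (y, u) \<Rightarrow> u * y))"
      using bound by (intro VZ.P.integrable_const_bound[where B = B]) auto
  qed simp
  also have "\<dots> = (LINT y|P. (lambda * y\<^sup>2) *\<^sub>R (LINT u|uniform01. h (u * y)))"
    unfolding size_biased_def using lambda_pos by (intro integral_density) auto
  finally show ?thesis by (simp add: integral_uniform01)
qed

text \<open>Reduces estimates for T = U Z to estimates for U y with y fixed: integrating min 1 |y|
  against the weight lambda y^2 gives \<open>truncated_moment\<close>. It serves both the tail of T
  and its truncated absolute moments.\<close>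

lemma integral_zero_bias_jump_le:
  assumes h [measurable]: "h \<in> borel_measurable borel" and bound: "\<And>x. \<bar>h x\<bar> \<le> B"
    and le: "\<And>y. (LINT u:{0..1}|lborel. h (u * y)) \<le> C * min 1 \<bar>y\<bar>"
  shows "(LINT t|zero_bias_jump. h t) \<le> C * truncated_moment"
proof -
  have C: "(LINT u:{0..1}|lborel. h (u * y)) = (LINT u|uniform01. h (u * y))" for y
    by (simp add: integral_uniform01)
  interpret V: real_distribution uniform01 by (rule real_distribution_uniform01)
  note [measurable_cong] = V.events_eq_borel
  have absV: "\<bar>LINT u|uniform01. h (u * y)\<bar> \<le> B" for y
  proof -
    have "\<bar>LINT u|uniform01. h (u * y)\<bar> \<le> (LINT u|uniform01. \<bar>h (u * y)\<bar>)" by (rule integral_abs_bound)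
    also have "\<dots> \<le> (LINT u|uniform01. B)"
      using bound order_trans[OF abs_ge_zero bound] by (intro integral_mono integrable_bounded_real[OF real_distribution_uniform01, of _ B]) auto
    finally show ?thesis by (simp add: V.prob_space[simplified])
  qed
  have trunc: "integrable P (\<lambda>y. y\<^sup>2 * min 1 \<bar>y\<bar>)"
    by (rule Bochner_Integration.integrable_bound[OF integrable_P_sq])
      (auto simp: abs_mult intro!: mult_left_le)
  have "(LINT t|zero_bias_jump. h t) = (LINT y|P. lambda * y\<^sup>2 * (LINT u|uniform01. h (u * y)))"
    using integral_zero_bias_jump[OF h bound] by (simp add: C)
  also have "\<dots> \<le> (LINT y|P. lambda * C * (y\<^sup>2 * min 1 \<bar>y\<bar>))"
  proof (rule integral_mono)
    show "integrable P (\<lambda>y. lambda * y\<^sup>2 * (LINT u|uniform01. h (u * y)))"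
    proof (rule Bochner_Integration.integrable_bound)
      show "integrable P (\<lambda>y. B * (lambda * y\<^sup>2))" using integrable_P_sq by simp
      show "AE y in P. norm (lambda * y\<^sup>2 * (LINT u|uniform01. h (u * y))) \<le> norm (B * (lambda * y\<^sup>2))"
        using abs_mult_bound(2)[OF absV] by (intro AE_I2) simp
    qed measurable
    show "integrable P (\<lambda>y. lambda * C * (y\<^sup>2 * min 1 \<bar>y\<bar>))" using trunc by simp
    fix y
    have "lambda * y\<^sup>2 * (LINT u|uniform01. h (u * y)) \<le> lambda * y\<^sup>2 * (C * min 1 \<bar>y\<bar>)"
      using le[of y] lambda_pos by (intro mult_left_mono) (auto simp: C)
    then show "lambda * y\<^sup>2 * (LINT u|uniform01. h (u * y)) \<le> lambda * C * (y\<^sup>2 * min 1 \<bar>y\<bar>)"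
      by (simp add: mult_ac)
  qed
  also have "\<dots> = C * truncated_moment"
    by (simp add: truncated_moment_def integral_distr)
  finally show ?thesis .
qed

text \<open>Centering makes the mean of X g(w) vanish, so only increments of g enter.\<close>

lemma jump_mean_centered:
  assumes "g \<in> borel_measurable borel" "\<And>x. \<bar>g x\<bar> \<le> B"
  shows "jump_mean g w = (LINT y|P. y * (g (w + y) - g w))"
proof -
  have "integrable P (\<lambda>y. y)" using integrable_X0 by (simp add: integrable_distr_eq)
  then have "(LINT y|P. y * g (w + y) - y * g w) = jump_mean g w - (LINT y|P. y) * g w"
    unfolding jump_mean_def using integrable_jump[OF assms, of w] by simp
  then show ?thesis using mean_zero by (simp add: integral_distr right_diff_distrib)
qed

text \<open>Testing Stein's identity on the truncation of \<open>w\<close> to \<open>[-1, 1]\<close> avoids second moments of \<open>W\<close>.\<close>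

lemma expectation_abs_W: "expectation (\<lambda>\<omega>. \<bar>W \<omega>\<bar>) \<le> 5 / 4"
proof -
  define g where "g = (\<lambda>w::real. max (- 1) (min 1 w))"
  have g [measurable]: "g \<in> borel_measurable borel" unfolding g_def by measurable
  have b: "\<bar>g x\<bar> \<le> 1" for x by (auto simp: g_def)
  have lip: "y * (g (w + y) - g w) \<le> y\<^sup>2" for y w
  proof -
    have "y * (g (w + y) - g w) \<le> \<bar>y\<bar> * \<bar>g (w + y) - g w\<bar>" by (simp flip: abs_mult)
    also have "\<dots> \<le> \<bar>y\<bar> * \<bar>y\<bar>" by (intro mult_left_mono) (auto simp: g_def)
    finally show ?thesis by (simp add: power2_eq_square)
  qed
  \<comment> \<open>The truncation is 1-Lipschitz, so its centered jump mean is at most the second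
    moment of a summand, which is 1 / lambda.\<close>
  have jm: "lambda * jump_mean g w \<le> 1" for w
  proof -
    have "integrable P (\<lambda>y. y)" using integrable_X0 by (simp add: integrable_distr_eq)
    then have "integrable P (\<lambda>y. y * g (w + y) - y * g w)"
      using integrable_jump[OF g b, of w] by simp
    then have "jump_mean g w \<le> (LINT y|P. y\<^sup>2)"
      unfolding jump_mean_centered[OF g b] using lip integrable_P_sq
      by (intro integral_mono) (auto simp: right_diff_distrib)
    then show ?thesis using integral_P_sq lambda_pos mult_left_mono[of "jump_mean g w" _ lambda] by fastforce
  qed
  have W: "integrable M W" using stein_identity_W(1)[OF g b] .
  have Wg: "integrable M (\<lambda>\<omega>. W \<omega> * g (W \<omega>))"
    by (rule Bochner_Integration.integrable_bound[OF W])
      (use abs_mult_bound(2)[OF b] in auto)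
  have mj [measurable]: "jump_mean g \<in> borel_measurable borel" by (rule measurable_jump_mean[OF g b])
  have "expectation (\<lambda>\<omega>. \<bar>W \<omega>\<bar>) \<le> expectation (\<lambda>\<omega>. W \<omega> * g (W \<omega>) + 1 / 4)"
  proof (rule integral_mono)
    fix \<omega>
    \<comment> \<open>On [-1, 1] the gap is (|w| - 1/2)^2; outside, w g(w) is already |w|. The added
      1/4 yields the constant 5/4.\<close>
    have "\<bar>w\<bar> \<le> w * g w + 1 / 4" for w
    proof (cases "\<bar>w\<bar> \<le> 1")
      case True
      then have "g w = w" by (auto simp: g_def)
      moreover have "0 \<le> (\<bar>w\<bar> - 1 / 2)\<^sup>2" by simp
      ultimately show ?thesis by (simp add: power2_eq_square algebra_simps flip: abs_mult)
    next
      case False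
      then show ?thesis by (auto simp: g_def)
    qed
    then show "\<bar>W \<omega>\<bar> \<le> W \<omega> * g (W \<omega>) + 1 / 4" .
  qed (use W Wg in auto)
  also have "\<dots> = expectation (\<lambda>\<omega>. W \<omega> * g (W \<omega>)) + 1 / 4" using Wg by (simp add: prob_space)
  also have "expectation (\<lambda>\<omega>. W \<omega> * g (W \<omega>)) = expectation (\<lambda>\<omega>. lambda * jump_mean g (W \<omega>))"
    using stein_identity_W(2)[OF g b] by simp
  also have "\<dots> \<le> expectation (\<lambda>\<omega>. 1)"
    using jm jump_mean_bound[OF g b] by (intro integral_mono integrable_mult_right integrable_const_bound) auto
  finally show ?thesis by (simp add: prob_space)
qed

text \<open>In the Stein identity the centered jump mean contributes one factor y and the increment
  formula a second one. Their product, weighted by lambda, is the density of Z, and the average over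
  u becomes an average over T. Boundedness of \<open>stein_rhs\<close> permits Fubini.\<close>

lemma zero_bias_identity:
  "(LINT w|distr M borel W. w * stein_sol x w)
    = (LINT t|zero_bias_jump. LINT w|distr M borel W. stein_rhs x (w + t))"
proof -
  let ?f = "stein_sol x" and ?f' = "stein_rhs x"
  interpret K: real_distribution zero_bias_jump by (rule real_distribution_zero_bias_jump)
  interpret KM: pair_prob_space zero_bias_jump M ..
  note [measurable_cong] = K.events_eq_borel
  have b: "\<bar>?f w\<bar> \<le> 2" for w using stein_sol_nonneg[of x w] stein_sol_le[of x w] by simp
  have jump: "lambda * jump_mean ?f w = (LINT t|zero_bias_jump. ?f' (w + t))" for w
  proof -
    have "lambda * jump_mean ?f w = (LINT y|P. lambda * (y * (y * (LINT u:{0..1}|lborel. ?f' (w + u * y)))))"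
      by (simp add: jump_mean_centered[OF _ b] stein_sol_increment)
    also have "\<dots> = (LINT y|P. lambda * y\<^sup>2 * (LINT u:{0..1}|lborel. ?f' (w + u * y)))"
      by (simp add: power2_eq_square mult_ac)
    also have "\<dots> = (LINT t|zero_bias_jump. ?f' (w + t))"
      by (rule integral_zero_bias_jump[symmetric, of "\<lambda>t. ?f' (w + t)" 1]) (auto simp: abs_stein_rhs_le)
    finally show ?thesis .
  qed
  have "(LINT w|distr M borel W. w * ?f w) = expectation (\<lambda>\<omega>. W \<omega> * ?f (W \<omega>))"
    by (simp add: integral_distr)
  also have "\<dots> = expectation (\<lambda>\<omega>. lambda * jump_mean ?f (W \<omega>))"
    using stein_identity_W(2)[of ?f 2] b by simp
  also have "\<dots> = expectation (\<lambda>\<omega>. LINT t|zero_bias_jump. ?f' (W \<omega> + t))"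
    by (simp only: jump)
  also have "\<dots> = (LINT t|zero_bias_jump. expectation (\<lambda>\<omega>. ?f' (W \<omega> + t)))"
  proof (rule KM.Fubini_integral)
    show "integrable (zero_bias_jump \<Otimes>\<^sub>M M) (\<lambda>(t, \<omega>). ?f' (W \<omega> + t))"
      by (rule KM.P.integrable_const_bound[where B = 1]) (auto simp: abs_stein_rhs_le)
  qed
  finally show ?thesis by (simp add: integral_distr)
qed

text \<open>A vanishing truncated moment would force X 0 = 0 almost surely, against unit variance.
  Positivity allows a smoothing width proportional to \<open>truncated_moment\<close>.\<close>

lemma truncated_moment_pos: "0 < truncated_moment"
proof -
  let ?h = "\<lambda>\<omega>. (X 0 \<omega>)\<^sup>2 * min 1 \<bar>X 0 \<omega>\<bar>"
  have int: "integrable M ?h"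
    by (rule Bochner_Integration.integrable_bound[OF integrable_sq])
      (auto simp: abs_mult intro!: mult_left_le)
  have "expectation ?h \<noteq> 0"
  proof
    assume "expectation ?h = 0"
    then have "AE \<omega> in M. ?h \<omega> = 0" using int by (subst (asm) integral_nonneg_eq_0_iff_AE) auto
    then have "AE \<omega> in M. (X 0 \<omega>)\<^sup>2 = 0" by eventually_elim (auto simp: min_def split: if_splits)
    then have "expectation (\<lambda>\<omega>. (X 0 \<omega>)\<^sup>2) = expectation (\<lambda>\<omega>. 0)" by (intro integral_cong_AE) auto
    then show False using unit_variance by simp
  qed
  moreover have "0 \<le> expectation ?h" by (intro integral_nonneg_AE) auto
  ultimately have "0 < expectation ?h" by linarith
  then show ?thesis using lambda_pos by (simp add: truncated_moment_def)
qed

end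

section \<open>The bound for concentration functions\<close>

text \<open>The probability that |U y| exceeds \<epsilon> is 1 - \<epsilon> / |y| when |y| >
  \<epsilon>, and 0 otherwise. The square (|y| - 2 \<epsilon>)^2 \<ge> 0 bounds it by |y| / (4
  \<epsilon>), half of what Markov's inequality gives. The condition 4 \<epsilon> \<le> 1 serves the
  other side of the minimum.\<close>

lemma measure_uniform01_tail:
  fixes \<epsilon> y :: real
  assumes "0 < \<epsilon>" "4 * \<epsilon> \<le> 1"
  shows "(LINT u:{0..1}|lborel. indicator {t. \<epsilon> < \<bar>t\<bar>} (u * y)) \<le> 1 / (4 * \<epsilon>) * min 1 \<bar>y\<bar>"
proof (cases "\<epsilon> < \<bar>y\<bar>")
  case False
  have *: "indicator {0..1} u *\<^sub>R indicator {t. \<epsilon> < \<bar>t\<bar>} (u * y) = (0::real)" for u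
  proof (cases "u \<in> {0..1}")
    case True
    then have "\<bar>u * y\<bar> \<le> 1 * \<bar>y\<bar>" unfolding abs_mult by (intro mult_right_mono) auto
    then show ?thesis using False by simp
  qed simp
  show ?thesis unfolding set_lebesgue_integral_def * using assms by simp
next
  case True
  then have y: "0 < \<bar>y\<bar>" using assms by linarith
  have *: "(indicator {0..1} u *\<^sub>R indicator {t. \<epsilon> < \<bar>t\<bar>} (u * y) :: real) = indicator {\<epsilon> / \<bar>y\<bar><..1} u" for u
  proof -
    have "0 < \<epsilon> / \<bar>y\<bar>" using y assms by simp
    moreover have "\<epsilon> < \<bar>u * y\<bar> \<longleftrightarrow> \<epsilon> / \<bar>y\<bar> < \<bar>u\<bar>"
      using y by (simp add: abs_mult divide_less_eq)
    ultimately show ?thesis by (auto simp: indicator_def)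
  qed
  have "\<epsilon> / \<bar>y\<bar> \<le> 1" using True y by (subst pos_divide_le_eq) auto
  then have "(LINT u:{0..1}|lborel. indicator {t. \<epsilon> < \<bar>t\<bar>} (u * y)) = 1 - \<epsilon> / \<bar>y\<bar>"
    unfolding set_lebesgue_integral_def * by simp
  also have "\<dots> \<le> 1 / (4 * \<epsilon>) * min 1 \<bar>y\<bar>"
  proof -
    have "1 - \<epsilon> / \<bar>y\<bar> \<le> 1 / (4 * \<epsilon>)"
    proof -
      have "1 \<le> 1 / (4 * \<epsilon>)" using assms by simp
      moreover have "0 \<le> \<epsilon> / \<bar>y\<bar>" using assms by simp
      ultimately show ?thesis by linarith
    qed
    moreover have "1 - \<epsilon> / \<bar>y\<bar> \<le> 1 / (4 * \<epsilon>) * \<bar>y\<bar>"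
    proof -
      have "0 \<le> (\<bar>y\<bar> - 2 * \<epsilon>)\<^sup>2" by simp
      then have "4 * \<epsilon> * (\<bar>y\<bar> - \<epsilon>) \<le> \<bar>y\<bar> * \<bar>y\<bar>" by (simp add: power2_eq_square algebra_simps)
      then show ?thesis using y assms by (simp add: field_simps)
    qed
    ultimately show ?thesis by (simp add: min_def)
  qed
  finally show ?thesis .
qed

lemma integral_uniform01_min:
  fixes a y :: real
  assumes "0 \<le> a" shows "(LINT u:{0..1}|lborel. min 1 (a * \<bar>u * y\<bar>)) \<le> min 1 (a * \<bar>y\<bar> / 2)"
proof -
  have "(LINT u:{0..1}|lborel. (u::real)) = (LINT u|lborel. u ^ 1 * indicator {0..1} u)"
    by (simp add: set_lebesgue_integral_def mult.commute)
  also have "\<dots> = 1 / 2" by (subst integral_power) auto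
  finally have half: "(LINT u|uniform01. u) = 1 / 2" by (simp add: integral_uniform01)
  interpret V: real_distribution uniform01 by (rule real_distribution_uniform01)
  let ?m = "\<lambda>u. min 1 (a * \<bar>u * y\<bar>)"
  have im: "integrable uniform01 ?m"
    using assms by (intro integrable_bounded_real[OF real_distribution_uniform01, of _ 1]) auto
  have nn: "AE u in uniform01. 0 \<le> u \<and> u \<le> 1"
    unfolding uniform01_def by (subst AE_density) (auto simp: indicator_def)
  have id: "integrable uniform01 (\<lambda>u. u)"
    by (rule V.integrable_const_bound[where B = 1]) (use nn in auto)
  have "(LINT u|uniform01. ?m u) \<le> (LINT u|uniform01. 1)"
    using im by (intro integral_mono) auto
  moreover have "(LINT u|uniform01. ?m u) \<le> (LINT u|uniform01. a * \<bar>y\<bar> * u)"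
  proof (rule integral_mono_AE)
    show "AE u in uniform01. ?m u \<le> a * \<bar>y\<bar> * u"
      using nn by eventually_elim (auto simp: abs_mult mult_ac min_le_iff_disj)
  qed (use im id in auto)
  moreover have "(LINT u|uniform01. a * \<bar>y\<bar> * u) = a * \<bar>y\<bar> / 2" using half by simp
  moreover have "(LINT u|uniform01. 1) = (1::real)" by (simp add: V.prob_space[simplified])
  ultimately have "(LINT u|uniform01. ?m u) \<le> min 1 (a * \<bar>y\<bar> / 2)" by linarith
  then show ?thesis by (simp add: integral_uniform01)
qed

section \<open>Numerical constants for the standardized sum\<close>

context standardized_poisson_sum
begin

lemma kolmogorov_W:
  assumes "7.4184 * truncated_moment < 1"
  shows "\<bar>cdf (distr M borel W) x - std_normal_cdf x\<bar> \<le> 3.7092 * truncated_moment"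
proof -
  let ?\<delta> = truncated_moment and ?K = zero_bias_jump
  \<comment> \<open>The tail bound \<open>truncated_moment\<close> / (4 \<epsilon>) then equals 1/7,
    as the deconvolution requires. The condition 4 \<epsilon> \<le> 1 says that 7 times the moment
    is at most 1, which the assumption gives.\<close>
  define \<epsilon> where "\<epsilon> = 7 / 4 * ?\<delta>"
  have \<mu>: "real_distribution (distr M borel W)" by (rule real_distribution_distr) simp
  have K: "real_distribution ?K" by (rule real_distribution_zero_bias_jump)
  interpret K: real_distribution ?K by fact
  have \<epsilon>: "0 < \<epsilon>" "4 * \<epsilon> \<le> 1" using assms truncated_moment_pos by (simp_all add: \<epsilon>_def)
  have dist: "\<bar>(LINT t|?K. cdf (distr M borel W) (y - t)) - std_normal_cdf y\<bar>
      \<le> (LINT t|?K. min 1 (13 / 4 * \<bar>t\<bar>))" for y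
  proof (rule zero_bias_kolmogorov[OF \<mu> K])
    show "integrable (distr M borel W) (\<lambda>w. w)"
      using stein_identity_W(1)[of "\<lambda>_. 0" 0] by (simp add: integrable_distr_eq)
    show "(LINT w|distr M borel W. \<bar>w\<bar>) \<le> 5 / 4"
      using expectation_abs_W by (simp add: integral_distr)
  qed (rule zero_bias_identity)
  have small: "measure ?K {t. \<epsilon> < \<bar>t\<bar>} \<le> 1 / 7"
  proof -
    have "measure ?K {t. \<epsilon> < \<bar>t\<bar>} = (LINT t|?K. indicator {t. \<epsilon> < \<bar>t\<bar>} t)" by simp
    also have "\<dots> \<le> 1 / (4 * \<epsilon>) * ?\<delta>"
      using measure_uniform01_tail[OF \<epsilon>] by (intro integral_zero_bias_jump_le[of _ 1]) (auto simp: indicator_def)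
    also have "\<dots> = 1 / 7" using truncated_moment_pos by (simp add: \<epsilon>_def)
    finally show ?thesis .
  qed
  have i: "integrable ?K (\<lambda>t. min 1 (a * \<bar>t\<bar>))" if "0 \<le> a" for a
    using that by (intro integrable_bounded_real[OF K, of _ 1]) auto
  have "(LINT t|?K. min 1 (13 / 4 * \<bar>t\<bar>)) + (LINT t|?K. min 1 (41 / 100 * \<bar>t\<bar>))
      = (LINT t|?K. min 1 (13 / 4 * \<bar>t\<bar>) + min 1 (41 / 100 * \<bar>t\<bar>))"
    using i[of "13 / 4"] i[of "41 / 100"] by simp
  also have "\<dots> \<le> 2 * ?\<delta>"
  proof (rule integral_zero_bias_jump_le)
    show "\<bar>min 1 (13 / 4 * \<bar>t\<bar>) + min 1 (41 / 100 * \<bar>t\<bar>)\<bar> \<le> 2" for t :: real by simp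
    fix y :: real
    have si: "set_integrable lborel {0..1} (\<lambda>u. min 1 (a * \<bar>u * y\<bar>))" if "0 \<le> a" for a
      unfolding set_integrable_def
      by (rule integrableI_bounded_set_indicator[where B = 1]) (use that in auto)
    have "(LINT u:{0..1}|lborel. min 1 (13 / 4 * \<bar>u * y\<bar>) + min 1 (41 / 100 * \<bar>u * y\<bar>))
      = (LINT u:{0..1}|lborel. min 1 (13 / 4 * \<bar>u * y\<bar>)) + (LINT u:{0..1}|lborel. min 1 (41 / 100 * \<bar>u * y\<bar>))"
      by (intro set_integral_add si) auto
    also have "\<dots> \<le> min 1 (13 / 4 * \<bar>y\<bar> / 2) + min 1 (41 / 100 * \<bar>y\<bar> / 2)"
      by (intro add_mono integral_uniform01_min) auto
    \<comment> \<open>For |y| \<le> 1 the slopes add up to 13/8 + 41/200 = 1.83 < 2; for larger |y|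
      each minimum is at most 1.\<close>
    also have "\<dots> \<le> 2 * min 1 \<bar>y\<bar>" by (simp add: min_def)
    finally show "(LINT u:{0..1}|lborel. min 1 (13 / 4 * \<bar>u * y\<bar>) + min 1 (41 / 100 * \<bar>u * y\<bar>)) \<le> 2 * min 1 \<bar>y\<bar>" .
  qed auto
  finally have "7 / 5 * ((LINT t|?K. min 1 (13 / 4 * \<bar>t\<bar>)) + (LINT t|?K. min 1 (41 / 100 * \<bar>t\<bar>)))
      \<le> 7 / 5 * (2 * ?\<delta>)"
    by (rule mult_left_mono) simp
  then have "\<bar>cdf (distr M borel W) x - std_normal_cdf x\<bar> \<le> 7 / 5 * (2 * ?\<delta>) + 6 / 5 * (41 / 100 * \<epsilon>)"
    using kolmogorov_deconvolution[OF \<mu> K dist less_imp_le[OF \<epsilon>(1)] small, of x] by linarith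
  \<comment> \<open>The total coefficient is 7/5 * 2 + 6/5 * 41/100 * 7/4 = 2.8 + 0.861 =
    3.661.\<close>
  also have "\<dots> \<le> 3.7092 * ?\<delta>" using truncated_moment_pos by (simp add: \<epsilon>_def)
  finally show ?thesis .
qed

text \<open>If the right-hand side is at least 1 there is nothing to prove, as both functions take
  values in [0, 1]. Otherwise the Kolmogorov bound applies, doubled.\<close>

lemma concentration_W:
  assumes z: "0 \<le> z"
  shows "\<bar>concentration M W z - folded_normal_cdf (z / 2)\<bar> \<le> 7.4184 * truncated_moment"
proof (cases "7.4184 * truncated_moment < 1")
  case True
  then show ?thesis
    using concentration_kolmogorov[OF prob_space_axioms measurable_W kolmogorov_W z] by simp
next
  case False
  have "std_normal_cdf (- (z / 2)) \<le> std_normal_cdf (z / 2)" using z by (intro std_normal_cdf_mono) simp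
  then have "0 \<le> folded_normal_cdf (z / 2)"
    using z std_normal_cdf_minus[of "z / 2"] by (simp add: folded_normal_cdf_def)
  then have "\<bar>concentration M W z - folded_normal_cdf (z / 2)\<bar> \<le> 1"
    using abs_folded_normal_cdf_le[of "z / 2"] concentration_bounds[OF prob_space_axioms, of W z] by linarith
  then show ?thesis using False by linarith
qed

end

text \<open>Division by s maps windows of length z bijectively to windows of length z / s, so both
  suprema range over the same set.\<close>

lemma concentration_scale:
  assumes "0 < s"
  shows "concentration M (\<lambda>\<omega>. \<xi> \<omega> / s) (z / s) = concentration M \<xi> z"
proof -
  let ?F = "\<lambda>x. \<P>(\<omega> in M. x \<le> \<xi> \<omega> / s \<and> \<xi> \<omega> / s \<le> x + z / s)"
  have "?F (x / s) = \<P>(\<omega> in M. x \<le> \<xi> \<omega> \<and> \<xi> \<omega> \<le> x + z)" for x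
    using assms by (simp add: divide_le_cancel flip: add_divide_distrib)
  then have "range (\<lambda>x. \<P>(\<omega> in M. x \<le> \<xi> \<omega> \<and> \<xi> \<omega> \<le> x + z)) = range (\<lambda>x. ?F (x / s))"
    by simp
  also have "\<dots> = ?F ` range (\<lambda>x. x / s)" by (simp only: image_image)
  also have "range (\<lambda>x. x / s) = UNIV" using assms by (intro surjI[of _ "\<lambda>x. x * s"]) simp
  finally show ?thesis unfolding concentration_def by (simp only:)
qed

theorem theorem5:
  fixes M :: "'a measure"
    and X :: "nat \<Rightarrow> 'a \<Rightarrow> real"
    and N :: "'a \<Rightarrow> nat"
    and \<sigma> lambda :: real
  assumes "prob_space M"
    and "jointly_indep M N X"
    and "\<And>n. distr M borel (X n) = distr M borel (X 0)"
    and "integrable M (\<lambda>\<omega>. (X 0 \<omega>)\<^sup>2)"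
    and "(LINT \<omega>|M. X 0 \<omega>) = 0"
    and "\<sigma> > 0"
    and "(LINT \<omega>|M. (X 0 \<omega>)\<^sup>2) = \<sigma>\<^sup>2"
    and "lambda > 0"
    and "distr M (count_space UNIV) N = measure_pmf (poisson_pmf lambda)"
  shows "(SUP z\<in>{0..}. \<bar>concentration M (random_sum X N) z
             - folded_normal_cdf (z / (2 * \<sigma> * sqrt lambda))\<bar>)
         \<le> 7.4184 / \<sigma>\<^sup>2 * (LINT \<omega>|M. (X 0 \<omega>)\<^sup>2 * min 1 (\<bar>X 0 \<omega>\<bar> / (\<sigma> * sqrt lambda)))"
proof -
  \<comment> \<open>The standard deviation of the random sum; dividing the summands by it gives the
    unit variance case.\<close>
  define s where "s = \<sigma> * sqrt lambda"
  have s: "0 < s" using assms(6,8) by (simp add: s_def)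
  have s2: "s\<^sup>2 = \<sigma>\<^sup>2 * lambda" using assms(8) by (simp add: s_def power_mult_distrib)
  define Y where "Y = (\<lambda>n \<omega>. X n \<omega> / s)"
  interpret prob_space M by fact
  have X [measurable]: "X n \<in> borel_measurable M" for n
    using assms(2) unfolding jointly_indep_def indep_vars_def by (auto dest: spec[of _ "Some n"])
  interpret standardized_poisson_sum M Y N lambda
  proof
    \<comment> \<open>Only the components \<open>Some n\<close> are rescaled; the count at
      \<open>None\<close> is kept.\<close>
    have "indep_vars (\<lambda>_. borel) (\<lambda>i. case_option (\<lambda>x. x) (\<lambda>_ x. x / s) i \<circ> case_option (\<lambda>\<omega>. real (N \<omega>)) X i) UNIV"
      using assms(2) unfolding jointly_indep_def
      by (intro indep_vars_compose[where M' = "\<lambda>_. borel"]) (auto split: option.split)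
    also have "(\<lambda>i. case_option (\<lambda>x. x) (\<lambda>_ x. x / s) i \<circ> case_option (\<lambda>\<omega>. real (N \<omega>)) X i) = case_option (\<lambda>\<omega>. real (N \<omega>)) Y"
      by (auto simp: Y_def fun_eq_iff split: option.split)
    finally show "jointly_indep M N Y" by (simp add: jointly_indep_def)
    show "distr M borel (Y n) = distr M borel (Y 0)" for n
    proof -
      have "distr M borel (Y n) = distr (distr M borel (X n)) borel (\<lambda>x. x / s)" for n
        by (subst distr_distr) (auto simp: Y_def comp_def)
      then show ?thesis using assms(3)[of n] by (simp only:)
    qed
    have "integrable M (X 0)"
      by (rule square_integrable_imp_integrable[OF X assms(4)])
    then show "integrable M (Y 0)" by (simp add: Y_def)
    show "integrable M (\<lambda>\<omega>. (Y 0 \<omega>)\<^sup>2)" using assms(4) by (simp add: Y_def power_divide)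
    show "expectation (Y 0) = 0" using assms(5) by (simp add: Y_def)
    show "lambda * expectation (\<lambda>\<omega>. (Y 0 \<omega>)\<^sup>2) = 1"
      using assms(6-8) by (simp add: Y_def power_divide s2)
  qed (use assms in auto)
  have sum: "random_sum Y N = (\<lambda>\<omega>. random_sum X N \<omega> / s)"
    by (simp add: random_sum_def Y_def fun_eq_iff sum_divide_distrib)
  \<comment> \<open>The factor lambda cancels against s^2 = \<sigma>^2 lambda, leaving the prefactor
    1 / \<sigma>^2 of the theorem.\<close>
  have "truncated_moment = lambda * expectation (\<lambda>\<omega>. (X 0 \<omega>)\<^sup>2 * min 1 (\<bar>X 0 \<omega>\<bar> / s) / s\<^sup>2)"
    unfolding truncated_moment_def using s by (simp add: Y_def power_divide)
  also have "\<dots> = 1 / \<sigma>\<^sup>2 * expectation (\<lambda>\<omega>. (X 0 \<omega>)\<^sup>2 * min 1 (\<bar>X 0 \<omega>\<bar> / s))"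
    using assms(6,8) by (simp add: s2)
  finally have tm: "truncated_moment = 1 / \<sigma>\<^sup>2 * expectation (\<lambda>\<omega>. (X 0 \<omega>)\<^sup>2 * min 1 (\<bar>X 0 \<omega>\<bar> / s))" .
  show ?thesis
  proof (rule cSUP_least)
    fix z :: real assume "z \<in> {0..}"
    then have "0 \<le> z / s" using s by simp
    from concentration_W[OF this] s
    show "\<bar>concentration M (random_sum X N) z - folded_normal_cdf (z / (2 * \<sigma> * sqrt lambda))\<bar>
      \<le> 7.4184 / \<sigma>\<^sup>2 * (LINT \<omega>|M. (X 0 \<omega>)\<^sup>2 * min 1 (\<bar>X 0 \<omega>\<bar> / (\<sigma> * sqrt lambda)))"
      unfolding sum concentration_scale[OF s] tm by (simp add: s_def mult_ac)
  qed simp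
qed

end
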